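(* Single-Agent Strong Implementability is in $\mathsf{P}$: there is an algorithm that, given an instance, decides whether $f$ is strongly implementable in time polynomial in the encoding length of the instance.
   Context: Single-Agent Strong Implementability. Instance: a finite set $X$ of social choices, a finite type set $\Theta$ of the single agent, a valuation function $V:X\times\Theta\rightarrow\mathbb{Q}$ given as a table of rationals in binary, and a social choice function $f:\Theta\rightarrow X$ given as a table. Question: is $f$ strongly implementable? Definitions: a mechanism $\Gamma=(S,g,P)$ consists of an (arbitrary) bid set $S$, an outcome function $g:S\rightarrow X$ and a payment function $P:S\rightarrow\mathbb{Q}$. The utility of the agent of type $\theta$ from bid $s$ is $U^\Gamma(s\mid\theta)=V(g(s),\theta)+P(s)$. A strategy is $\alpha:\Theta\rightarrow S$; it is an equilibrium if $U^\Gamma(\alpha(\theta)\mid\theta)\ge U^\Gamma(\bar s\mid\theta)$ for all $\theta\in\Theta$, $\bar s\in S$. $\Gamma$ strongly implements $f$ if it has at least one equilibrium and every equilibrium $\alpha$ satisfies $g\circ\alpha=f$; $f$ is strongly implementable if some mechanism strongly implements it. *)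

theory Defs
  imports Complex_Main "HOL-Library.Countable_Set" "HOL-Computational_Algebra.Polynomial"
begin

section \<open>Mechanisms for a single agent\<close>

record ('s, 'x) mechanism =
  bids :: "'s set"
  outcome :: "'s \<Rightarrow> 'x"
  payment :: "'s \<Rightarrow> rat"

definition mechanism_on :: "'x set \<Rightarrow> ('s, 'x) mechanism \<Rightarrow> bool" where
  "mechanism_on X \<Gamma> \<longleftrightarrow> (\<forall>s\<in>bids \<Gamma>. outcome \<Gamma> s \<in> X)"

definition utility ::
    "('x \<Rightarrow> 't \<Rightarrow> rat) \<Rightarrow> ('s, 'x) mechanism \<Rightarrow> 's \<Rightarrow> 't \<Rightarrow> rat" where
  "utility V \<Gamma> s \<theta> = V (outcome \<Gamma> s) \<theta> + payment \<Gamma> s"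

definition strategy :: "'t set \<Rightarrow> ('s, 'x) mechanism \<Rightarrow> ('t \<Rightarrow> 's) \<Rightarrow> bool" where
  "strategy \<Theta> \<Gamma> \<alpha> \<longleftrightarrow> (\<forall>\<theta>\<in>\<Theta>. \<alpha> \<theta> \<in> bids \<Gamma>)"

definition equilibrium ::
    "'t set \<Rightarrow> ('x \<Rightarrow> 't \<Rightarrow> rat) \<Rightarrow> ('s, 'x) mechanism \<Rightarrow> ('t \<Rightarrow> 's) \<Rightarrow> bool" where
  "equilibrium \<Theta> V \<Gamma> \<alpha> \<longleftrightarrow>
     strategy \<Theta> \<Gamma> \<alpha> \<and>
     (\<forall>\<theta>\<in>\<Theta>. \<forall>s\<in>bids \<Gamma>. utility V \<Gamma> (\<alpha> \<theta>) \<theta> \<ge> utility V \<Gamma> s \<theta>)"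

definition strongly_implements ::
    "'x set \<Rightarrow> 't set \<Rightarrow> ('x \<Rightarrow> 't \<Rightarrow> rat) \<Rightarrow> ('t \<Rightarrow> 'x) \<Rightarrow> ('s, 'x) mechanism \<Rightarrow> bool" where
  "strongly_implements X \<Theta> V f \<Gamma> \<longleftrightarrow>
     mechanism_on X \<Gamma> \<and>
     (\<exists>\<alpha>. equilibrium \<Theta> V \<Gamma> \<alpha>) \<and>
     (\<forall>\<alpha>. equilibrium \<Theta> V \<Gamma> \<alpha> \<longrightarrow> (\<forall>\<theta>\<in>\<Theta>. outcome \<Gamma> (\<alpha> \<theta>) = f \<theta>))"

text \<open>Bid sets are arbitrary sets, but HOL cannot quantify existentially over types, so a
  universe of bids has to be fixed. Nothing is lost by taking bids from \<^typ>\<open>nat\<close>: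
  this is \<open>strongly_implementableI\<close> below.\<close>

definition strongly_implementable ::
    "'x set \<Rightarrow> 't set \<Rightarrow> ('x \<Rightarrow> 't \<Rightarrow> rat) \<Rightarrow> ('t \<Rightarrow> 'x) \<Rightarrow> bool" where
  "strongly_implementable X \<Theta> V f \<longleftrightarrow>
     (\<exists>\<Gamma> :: (nat, 'x) mechanism. strongly_implements X \<Theta> V f \<Gamma>)"

lemma strongly_implementableI:
  fixes \<Gamma> :: "('s, 'x) mechanism"
  assumes "finite X" and impl: "strongly_implements X \<Theta> V f \<Gamma>"
  shows "strongly_implementable X \<Theta> V f"
proof -
  define C where "C = X \<times> (UNIV :: rat set)"
  define h where "h = to_nat_on C"
  have "countable C"
    unfolding C_def using assms(1) by (intro countable_SIGMA) (auto simp: countable_finite)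
  then have inj: "inj_on h C"
    unfolding h_def by (rule inj_on_to_nat_on)
  define c where "c s = h (outcome \<Gamma> s, payment \<Gamma> s)" for s
  define \<Gamma>' :: "(nat, 'x) mechanism" where
    "\<Gamma>' = \<lparr>bids = c ` bids \<Gamma>, outcome = (\<lambda>i. fst (inv_into C h i)),
           payment = (\<lambda>i. snd (inv_into C h i))\<rparr>"
  have on: "mechanism_on X \<Gamma>" using impl by (simp add: strongly_implements_def)
  have inv: "inv_into C h (c s) = (outcome \<Gamma> s, payment \<Gamma> s)" if "s \<in> bids \<Gamma>" for s
    unfolding c_def using on that
    by (intro inv_into_f_f[OF inj]) (auto simp: C_def mechanism_on_def)
  have b: "bids \<Gamma>' = c ` bids \<Gamma>" by (simp add: \<Gamma>'_def)
  have o: "outcome \<Gamma>' (c s) = outcome \<Gamma> s" if "s \<in> bids \<Gamma>" for s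
    by (simp add: \<Gamma>'_def inv that)
  have u: "utility V \<Gamma>' (c s) \<theta> = utility V \<Gamma> s \<theta>" if "s \<in> bids \<Gamma>" for s \<theta>
    by (simp add: \<Gamma>'_def utility_def inv that)
  have "mechanism_on X \<Gamma>'" using on by (auto simp: mechanism_on_def b o)
  moreover have "\<exists>\<alpha>. equilibrium \<Theta> V \<Gamma>' \<alpha>"
  proof -
    obtain \<alpha> where "equilibrium \<Theta> V \<Gamma> \<alpha>"
      using impl by (auto simp: strongly_implements_def)
    then have "equilibrium \<Theta> V \<Gamma>' (\<lambda>\<theta>. c (\<alpha> \<theta>))"
      by (auto simp: equilibrium_def strategy_def b u)
    then show ?thesis by blast
  qed
  moreover have "outcome \<Gamma>' (\<alpha>' \<theta>) = f \<theta>"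
    if eq: "equilibrium \<Theta> V \<Gamma>' \<alpha>'" and th: "\<theta> \<in> \<Theta>" for \<alpha>' \<theta>
  proof -
    have "\<forall>\<theta>\<in>\<Theta>. \<exists>s. s \<in> bids \<Gamma> \<and> \<alpha>' \<theta> = c s"
      using eq by (auto simp: equilibrium_def strategy_def b)
    then obtain \<alpha> where \<alpha>: "\<And>\<theta>. \<theta> \<in> \<Theta> \<Longrightarrow> \<alpha> \<theta> \<in> bids \<Gamma> \<and> \<alpha>' \<theta> = c (\<alpha> \<theta>)"
      by metis
    have "equilibrium \<Theta> V \<Gamma> \<alpha>"
      unfolding equilibrium_def strategy_def
    proof (intro conjI ballI)
      fix \<theta> s assume "\<theta> \<in> \<Theta>" "s \<in> bids \<Gamma>"
      moreover from this have "utility V \<Gamma>' (\<alpha>' \<theta>) \<theta> \<ge> utility V \<Gamma>' (c s) \<theta>"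
        using eq by (auto simp: equilibrium_def b)
      ultimately show "utility V \<Gamma> (\<alpha> \<theta>) \<theta> \<ge> utility V \<Gamma> s \<theta>"
        using \<alpha> u by simp
    qed (use \<alpha> in auto)
    then have "outcome \<Gamma> (\<alpha> \<theta>) = f \<theta>"
      using impl th by (auto simp: strongly_implements_def)
    then show ?thesis using \<alpha>[OF th] o by simp
  qed
  ultimately have "strongly_implements X \<Theta> V f \<Gamma>'"
    unfolding strongly_implements_def by blast
  then show ?thesis
    unfolding strongly_implementable_def by blast
qed


section \<open>Instances and their encoding\<close>

text \<open>Choices and types are the indices of the tables: row \<open>x\<close> of \<open>val_table\<close> lists the
  valuations of choice \<open>x\<close> by the types, and entry \<open>\<theta>\<close> of \<open>scf_table\<close> is the choice
  prescribed for type \<open>\<theta>\<close>. A rational is given by a numerator and a positive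
  denominator, not necessarily in lowest terms.\<close>

record sa_instance =
  val_table :: "(int \<times> nat) list list"
  scf_table :: "nat list"

definition choices :: "sa_instance \<Rightarrow> nat set" where
  "choices I = {..<length (val_table I)}"

definition types :: "sa_instance \<Rightarrow> nat set" where
  "types I = {..<length (scf_table I)}"

definition valuation :: "sa_instance \<Rightarrow> nat \<Rightarrow> nat \<Rightarrow> rat" where
  "valuation I x \<theta> = (case val_table I ! x ! \<theta> of (a, b) \<Rightarrow> of_int a / of_nat b)"

definition scf :: "sa_instance \<Rightarrow> nat \<Rightarrow> nat" where
  "scf I \<theta> = scf_table I ! \<theta>"

definition valid_instance :: "sa_instance \<Rightarrow> bool" where
  "valid_instance I \<longleftrightarrow>
     (\<forall>row\<in>set (val_table I). length row = length (scf_table I) \<and> (\<forall>(a, b)\<in>set row. b > 0)) \<and>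
     (\<forall>\<theta>\<in>types I. scf I \<theta> \<in> choices I)"

text \<open>Binary digits, least significant first and without leading zeros.\<close>

fun nat_bits :: "nat \<Rightarrow> bool list" where
  "nat_bits n = (if n = 0 then [] else odd n # nat_bits (n div 2))"

declare nat_bits.simps [simp del]

text \<open>Every list element is announced by \<^const>\<open>True\<close>, the end of the list by
  \<^const>\<open>False\<close>; this makes all encodings below prefix-free.\<close>

definition enc_list :: "('a \<Rightarrow> bool list) \<Rightarrow> 'a list \<Rightarrow> bool list" where
  "enc_list e xs = concat (map (\<lambda>x. True # e x) xs) @ [False]"

definition enc_nat :: "nat \<Rightarrow> bool list" where
  "enc_nat n = enc_list (\<lambda>b. [b]) (nat_bits n)"

definition enc_frac :: "int \<times> nat \<Rightarrow> bool list" where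
  "enc_frac = (\<lambda>(a, b). (a < 0) # enc_nat (nat \<bar>a\<bar>) @ enc_nat b)"

definition enc_instance :: "sa_instance \<Rightarrow> bool list" where
  "enc_instance I = enc_list (enc_list enc_frac) (val_table I) @ enc_list enc_nat (scf_table I)"

definition single_agent_strong_implementability :: "bool list set" where
  "single_agent_strong_implementability =
     {enc_instance I | I. valid_instance I \<and>
        strongly_implementable (choices I) (types I) (valuation I) (scf I)}"

text \<open>The encoding is injective, so membership of a word does not depend on the choice of
  the instance it encodes.\<close>

definition prefix_free_code :: "('a \<Rightarrow> bool list) \<Rightarrow> bool" where
  "prefix_free_code e \<longleftrightarrow> (\<forall>x y u v. e x @ u = e y @ v \<longrightarrow> x = y \<and> u = v)"

lemma prefix_free_codeD:
  "prefix_free_code e \<Longrightarrow> e x @ u = e y @ v \<Longrightarrow> x = y \<and> u = v"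
  by (auto simp: prefix_free_code_def)

lemma prefix_free_enc_list:
  assumes "prefix_free_code e"
  shows "prefix_free_code (enc_list e)"
  unfolding prefix_free_code_def
proof (intro allI impI)
  fix xs ys u v
  assume "enc_list e xs @ u = enc_list e ys @ v"
  then show "xs = ys \<and> u = v"
  proof (induction xs arbitrary: ys)
    case Nil
    then show ?case by (cases ys) (auto simp: enc_list_def)
  next
    case (Cons x xs)
    then obtain y ys' where ys: "ys = y # ys'"
      by (cases ys) (auto simp: enc_list_def)
    with Cons.prems have "e x @ enc_list e xs @ u = e y @ enc_list e ys' @ v"
      by (simp add: enc_list_def)
    then have "x = y \<and> enc_list e xs @ u = enc_list e ys' @ v"
      by (rule prefix_free_codeD[OF assms])
    with Cons.IH ys show ?case by blast
  qed
qed

lemma inj_nat_bits: "nat_bits m = nat_bits n \<Longrightarrow> m = n"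
proof (induction m arbitrary: n rule: less_induct)
  case (less m)
  show ?case
  proof (cases "m = 0 \<or> n = 0")
    case True
    then show ?thesis using less.prems by (auto simp: nat_bits.simps split: if_splits)
  next
    case False
    then have *: "odd m = odd n" "nat_bits (m div 2) = nat_bits (n div 2)"
      using less.prems by (simp_all add: nat_bits.simps[of m] nat_bits.simps[of n])
    have "m div 2 = n div 2" using less.IH[OF _ *(2)] False by simp
    with *(1) show ?thesis by presburger
  qed
qed

lemma prefix_free_enc_nat: "prefix_free_code enc_nat"
proof -
  have "prefix_free_code (enc_list (\<lambda>b. [b]))"
    by (rule prefix_free_enc_list) (auto simp: prefix_free_code_def)
  then show ?thesis
    unfolding prefix_free_code_def enc_nat_def using inj_nat_bits by blast
qed

lemma prefix_free_enc_frac: "prefix_free_code enc_frac"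
  unfolding prefix_free_code_def
proof (intro allI impI)
  fix p q u v
  assume eq: "enc_frac p @ u = enc_frac q @ v"
  obtain a b c d where pq: "p = (a, b)" "q = (c, d)" by (cases p, cases q)
  have sgn: "(a < 0) = (c < 0)"
    and "enc_nat (nat \<bar>a\<bar>) @ enc_nat b @ u = enc_nat (nat \<bar>c\<bar>) @ enc_nat d @ v"
    using eq by (simp_all add: pq enc_frac_def)
  then have "nat \<bar>a\<bar> = nat \<bar>c\<bar>" "enc_nat b @ u = enc_nat d @ v"
    using prefix_free_codeD[OF prefix_free_enc_nat] by blast+
  with sgn show "p = q \<and> u = v"
    using prefix_free_codeD[OF prefix_free_enc_nat, of b u d v] by (auto simp: pq)
qed

lemma inj_enc_instance: "inj enc_instance"
proof (rule injI)
  fix I J assume "enc_instance I = enc_instance J"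
  then have "val_table I = val_table J \<and>
      enc_list enc_nat (scf_table I) = enc_list enc_nat (scf_table J)"
    using prefix_free_codeD[OF prefix_free_enc_list[OF prefix_free_enc_list[OF prefix_free_enc_frac]]]
    by (simp add: enc_instance_def)
  moreover from this have "scf_table I = scf_table J"
    using prefix_free_codeD[OF prefix_free_enc_list[OF prefix_free_enc_nat],
        of "scf_table I" "[]" "scf_table J" "[]"] by simp
  ultimately show "I = J" by simp
qed


section \<open>Deterministic multi-tape Turing machines and the class P\<close>

text \<open>Symbol 0 is the blank. States, symbols and tapes are numbered from 0, and the finitely
  many of each are bounded by the first three fields of a machine. Tapes are infinite in
  both directions; a tape consists of its contents and the head position.\<close>

type_synonym tape = "(int \<Rightarrow> nat) \<times> int"

datatype move = MoveLeft | Stay | MoveRight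

record turing_machine =
  num_tapes :: nat
  num_states :: nat
  num_symbols :: nat
  trans :: "nat \<Rightarrow> nat list \<Rightarrow> nat \<times> (nat \<times> move) list"
  start_state :: nat
  accept_state :: nat
  reject_state :: nat

definition wf_tm :: "turing_machine \<Rightarrow> bool" where
  "wf_tm M \<longleftrightarrow>
     num_tapes M \<ge> 1 \<and> num_symbols M \<ge> 3 \<and>
     start_state M < num_states M \<and> accept_state M < num_states M \<and>
     reject_state M < num_states M \<and> accept_state M \<noteq> reject_state M \<and>
     (\<forall>q syms. q < num_states M \<and> length syms = num_tapes M \<and> (\<forall>a\<in>set syms. a < num_symbols M) \<longrightarrow>
        (case trans M q syms of (q', acts) \<Rightarrow>
           q' < num_states M \<and> length acts = num_tapes M \<and>
           (\<forall>(a, d)\<in>set acts. a < num_symbols M)))"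

definition read_tape :: "tape \<Rightarrow> nat" where
  "read_tape t = fst t (snd t)"

fun move_head :: "move \<Rightarrow> int \<Rightarrow> int" where
  "move_head MoveLeft p = p - 1"
| "move_head Stay p = p"
| "move_head MoveRight p = p + 1"

fun act_tape :: "nat \<times> move \<Rightarrow> tape \<Rightarrow> tape" where
  "act_tape (a, d) (c, p) = (c(p := a), move_head d p)"

type_synonym config = "nat \<times> tape list"

definition tm_step :: "turing_machine \<Rightarrow> config \<Rightarrow> config" where
  "tm_step M = (\<lambda>(q, ts).
     if q = accept_state M \<or> q = reject_state M then (q, ts)
     else case trans M q (map read_tape ts) of (q', acts) \<Rightarrow> (q', map2 act_tape acts ts))"

text \<open>The input is written on tape 0 from position 0 on, with \<^const>\<open>False\<close> and
  \<^const>\<open>True\<close> represented by the symbols 1 and 2.\<close>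

definition input_tape :: "bool list \<Rightarrow> tape" where
  "input_tape w =
     (\<lambda>p. if 0 \<le> p \<and> p < int (length w) then (if w ! nat p then 2 else 1) else 0, 0)"

definition blank_tape :: tape where
  "blank_tape = (\<lambda>_. 0, 0)"

definition init_config :: "turing_machine \<Rightarrow> bool list \<Rightarrow> config" where
  "init_config M w = (start_state M, input_tape w # replicate (num_tapes M - 1) blank_tape)"

text \<open>Halting configurations are fixed points of \<^const>\<open>tm_step\<close>, so the state after
  \<open>T (length w)\<close> steps tells whether the machine has halted by then, and how.\<close>

definition decides_in_time :: "turing_machine \<Rightarrow> bool list set \<Rightarrow> (nat \<Rightarrow> nat) \<Rightarrow> bool" where
  "decides_in_time M L T \<longleftrightarrow>
     (\<forall>w. fst ((tm_step M ^^ T (length w)) (init_config M w)) =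
            (if w \<in> L then accept_state M else reject_state M))"

definition class_P :: "bool list set set" where
  "class_P = {L. \<exists>M (p :: nat poly). wf_tm M \<and> decides_in_time M L (poly p)}"

end

theory Submission
  imports Defs
begin

text \<open>A mechanism that strongly implements \<open>f\<close> is a choice of payments \<open>p \<theta>\<close> such that
  \<open>p \<theta>' \<le> p \<theta>\<close> if \<open>f \<theta> = f \<theta>'\<close>, and
  \<open>p \<theta>' - p \<theta> < V (f \<theta>) \<theta> - V (f \<theta>') \<theta>\<close> otherwise: a non-strict second inequality would leave
  type \<open>\<theta>\<close> an equilibrium report with the wrong outcome. Such a system of strict and weak
  difference constraints is decided by eliminating one variable after the other, as in the
  Floyd--Warshall algorithm: the new bound on the difference of two variables is the minimum of
  the old bound and the bound through the eliminated variable. Over a common denominator, each elimination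
  makes the numbers longer by at most one binary digit.

  Turing machines enter only through a language of while programs on a fixed number of stacks,
  one per tape. Binary trees in prefix notation on one of the stacks represent data of all types, and
  the functions on them that are computable in polynomial time are closed under composition and under
  recursion on lists with results of polynomial size, which is enough to express the procedure.\<close>


section \<open>A stack language and its compilation to Turing machines\<close>

text \<open>One payment per type suffices because only the bids of one fixed equilibrium matter:
  dropping all other bids keeps the inequalities. Strict and weak bounds can be mixed because
  payments range over a dense field, where pairwise compatible lower and upper bounds on one unknown
  have a common solution. Growth by one digit per elimination, as opposed to doubling, is what keeps
  the procedure polynomial: there is one elimination per type. The common denominator is simply the
  product of all denominators; it needs no gcd, and its length is linear in the size of the input.
  Most of the work is caused by the explicit machine model. Stack 0 is the work stack, 1 and 2
  receive copies while a tree is read, 3 counts pending trees, and 4 stores intermediate results. Of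
  the four symbols, 0 is the blank and signals an empty stack, 1 and 2 spell trees, and 3 marks the
  bottom of temporary contents.\<close>

datatype com =
    Push nat nat
  | Pop nat
  | Seq com com (infixr ";;" 60)
  | Cond nat nat com com
  | While nat nat com

definition peek :: "nat list \<Rightarrow> nat" where
  "peek xs = (case xs of [] \<Rightarrow> 0 | x # _ \<Rightarrow> x)"

lemma peek_simps [simp]: "peek [] = 0" "peek (x # xs) = x"
  by (simp_all add: peek_def)

text \<open>\<open>Cond r a c d\<close> branches on whether the top of stack \<open>r\<close> is \<open>a\<close>, and
  \<open>While r a c\<close> runs until the top of stack \<open>r\<close> is \<open>a\<close>. The number of steps in
  \<open>exec\<close> is only an upper bound.\<close>

inductive exec :: "com \<Rightarrow> (nat \<Rightarrow> nat list) \<Rightarrow> nat \<Rightarrow> (nat \<Rightarrow> nat list) \<Rightarrow> bool" where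
  exec_weaken: "exec c s t s' \<Longrightarrow> t \<le> t' \<Longrightarrow> exec c s t' s'"
| exec_Push: "r < 5 \<Longrightarrow> a < 4 \<Longrightarrow> exec (Push r a) s 2 (s(r := a # s r))"
| exec_Pop: "r < 5 \<Longrightarrow> exec (Pop r) s 1 (s(r := tl (s r)))"
| exec_Seq: "exec c s t s' \<Longrightarrow> exec d s' t' s'' \<Longrightarrow> exec (c ;; d) s (t + t') s''"
| exec_Cond_True: "r < 5 \<Longrightarrow> peek (s r) = a \<Longrightarrow> exec c s t s' \<Longrightarrow> exec (Cond r a c d) s (t + 2) s'"
| exec_Cond_False: "r < 5 \<Longrightarrow> peek (s r) \<noteq> a \<Longrightarrow> exec d s t s' \<Longrightarrow> exec (Cond r a c d) s (t + 2) s'"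
| exec_While_end: "r < 5 \<Longrightarrow> peek (s r) = a \<Longrightarrow> exec (While r a c) s 1 s"
| exec_While_step: "r < 5 \<Longrightarrow> peek (s r) \<noteq> a \<Longrightarrow> exec c s t s' \<Longrightarrow> exec (While r a c) s' t' s''
    \<Longrightarrow> exec (While r a c) s (t + t' + 2) s''"

datatype ins =
    MoveI nat move
  | WriteI nat nat
  | JumpI nat nat nat nat

fun com_size :: "com \<Rightarrow> nat" where
  "com_size (Push r a) = 2"
| "com_size (Pop r) = 1"
| "com_size (c ;; d) = com_size c + com_size d"
| "com_size (Cond r a c d) = com_size c + com_size d + 2"
| "com_size (While r a c) = com_size c + 2"

text \<open>\<open>n\<close> is the address of the first instruction, since jump targets are
  absolute. A jump with two equal targets is unconditional, whatever it tests. In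
  \<open>Cond\<close> the alternative comes first and then jumps over the code for the positive
  case.\<close>

fun compile :: "nat \<Rightarrow> com \<Rightarrow> ins list" where
  "compile n (Push r a) = [MoveI r MoveLeft, WriteI r a]"
| "compile n (Pop r) = [MoveI r MoveRight]"
| "compile n (c ;; d) = compile n c @ compile (n + com_size c) d"
| "compile n (Cond r a c d) =
     JumpI r a (n + com_size d + 2) (n + 1) # compile (n + 1) d @
     JumpI 0 0 (n + com_size c + com_size d + 2) (n + com_size c + com_size d + 2) #
     compile (n + com_size d + 2) c"
| "compile n (While r a c) =
     JumpI r a (n + com_size c + 2) (n + 1) # compile (n + 1) c @ [JumpI 0 0 n n]"

lemma length_compile [simp]: "length (compile n c) = com_size c"
  by (induction c arbitrary: n) auto

definition keep :: "nat list \<Rightarrow> (nat \<times> move) list" where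
  "keep syms = map (\<lambda>a. (a, Stay)) syms"

fun ins_trans :: "ins \<Rightarrow> nat \<Rightarrow> nat list \<Rightarrow> nat \<times> (nat \<times> move) list" where
  "ins_trans (MoveI r d) q syms = (q + 1, (keep syms)[r := (syms ! r, d)])"
| "ins_trans (WriteI r a) q syms = (q + 1, (keep syms)[r := (min a 3, Stay)])"
| "ins_trans (JumpI r a p p') q syms = (if syms ! r = a then p else p', keep syms)"

text \<open>Addresses are states, and the two states behind the program are the halting ones, so
  running off the end accepts. The cap on the next state here and the cap on the written symbol in
  \<open>ins_trans\<close> make the machine well formed for every instruction list.\<close>

definition machine :: "ins list \<Rightarrow> turing_machine" where
  "machine P = \<lparr>num_tapes = 5, num_states = length P + 2, num_symbols = 4,
     trans = (\<lambda>q syms. if q < length P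
        then case ins_trans (P ! q) q syms of (q', acts) \<Rightarrow> (min q' (length P + 1), acts)
        else (q, keep syms)),
     start_state = 0, accept_state = length P, reject_state = length P + 1\<rparr>"

lemma wf_machine: "wf_tm (machine P)"
proof -
  have "case trans (machine P) q syms of (q', acts) \<Rightarrow>
           q' < length P + 2 \<and> length acts = 5 \<and> (\<forall>(a, d)\<in>set acts. a < 4)"
    if "q < length P + 2" "length syms = 5" "\<forall>a\<in>set syms. a < 4" for q syms
  proof (cases "q < length P")
    case True
    have keep: "length (keep syms) = 5" "\<forall>(a, d)\<in>set (keep syms). a < 4"
      using that by (auto simp: keep_def)
    \<comment> \<open>A tape number of 5 or more is harmless: updating a list out of range changes
      nothing.\<close>
    have upd: "\<forall>(a, d)\<in>set ((keep syms)[r := (b, d')]). a < 4" if "b < 4 \<or> r \<ge> 5" for r b d'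
      using that keep set_update_subset_insert[of "keep syms" r "(b, d')"]
      by (cases "r < 5") (auto simp: list_update_beyond)
    show ?thesis
    proof (cases "P ! q")
      case (MoveI r d)
      have "syms ! r < 4 \<or> r \<ge> 5" using that by (metis not_less nth_mem)
      then show ?thesis using True MoveI keep upd[of "syms ! r" r d] by (simp add: machine_def)
    next
      case (WriteI r a)
      have "min a 3 < 4 \<or> r \<ge> 5" by linarith
      then show ?thesis using True WriteI keep upd[of "min a 3" r Stay] by (simp add: machine_def)
    next
      case (JumpI r a p p')
      then show ?thesis using True keep by (simp add: machine_def)
    qed
  next
    case False
    then show ?thesis using that by (auto simp: machine_def keep_def)
  qed
  then show ?thesis
    unfolding wf_tm_def by (simp add: machine_def)
qed

text \<open>A stack lies on its tape from the head to the right; cells to the left are garbage. Hence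
  the input tape already is a stack, and a push has to move before it writes.\<close>

definition holds_stack :: "tape \<Rightarrow> nat list \<Rightarrow> bool" where
  "holds_stack t xs \<longleftrightarrow> (\<forall>i. fst t (snd t + int i) = (if i < length xs then xs ! i else 0))"

definition holds_stacks :: "tape list \<Rightarrow> (nat \<Rightarrow> nat list) \<Rightarrow> bool" where
  "holds_stacks ts s \<longleftrightarrow> length ts = 5 \<and> (\<forall>r<5. holds_stack (ts ! r) (s r))"

lemma holds_stack_read: "holds_stack t xs \<Longrightarrow> read_tape t = peek xs"
  unfolding holds_stack_def read_tape_def
  by (drule spec[of _ 0]) (auto simp: peek_def split: list.splits)

lemma holds_stacks_read: "holds_stacks ts s \<Longrightarrow> r < 5 \<Longrightarrow> read_tape (ts ! r) = peek (s r)"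
  by (simp add: holds_stacks_def holds_stack_read)

lemma holds_stack_pop:
  assumes "holds_stack t xs"
  shows "holds_stack (act_tape (read_tape t, MoveRight) t) (tl xs)"
  unfolding holds_stack_def
proof
  fix i
  have "fst t (snd t + int (Suc i)) = (if Suc i < length xs then xs ! Suc i else 0)"
    using assms unfolding holds_stack_def by blast
  then show "fst (act_tape (read_tape t, MoveRight) t) (snd (act_tape (read_tape t, MoveRight) t) + int i)
      = (if i < length (tl xs) then tl xs ! i else 0)"
    by (cases t; cases xs) (auto simp: read_tape_def add.assoc)
qed

lemma holds_stack_push:
  assumes "holds_stack t xs"
  shows "holds_stack (act_tape (a, Stay) (act_tape (read_tape t, MoveLeft) t)) (a # xs)"
  unfolding holds_stack_def
proof
  fix i
  have "fst t (snd t + int (i - 1)) = (if i - 1 < length xs then xs ! (i - 1) else 0)"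
    using assms unfolding holds_stack_def by blast
  then show "fst (act_tape (a, Stay) (act_tape (read_tape t, MoveLeft) t))
        (snd (act_tape (a, Stay) (act_tape (read_tape t, MoveLeft) t)) + int i)
      = (if i < length (a # xs) then (a # xs) ! i else 0)"
    by (cases t; cases i) (auto simp: read_tape_def)
qed

lemma act_tape_read [simp]: "act_tape (read_tape t, Stay) t = t"
  by (cases t) (simp add: read_tape_def)

lemma map2_act_keep:
  "length acts = length ts \<Longrightarrow> acts = (keep (map read_tape ts))[r := x]
    \<Longrightarrow> map2 act_tape acts ts = ts[r := act_tape x (ts ! r)]"
  by (rule nth_equalityI; simp add: keep_def; rename_tac i; case_tac "i = r"; simp)

lemma map2_act_keep0: "map2 act_tape (keep (map read_tape ts)) ts = ts"
  by (rule nth_equalityI) (auto simp: keep_def)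

lemma tm_step_machine:
  assumes "q < length P" "length ts = 5"
  shows "P ! q = MoveI r d \<Longrightarrow> r < 5 \<Longrightarrow>
      tm_step (machine P) (q, ts) = (q + 1, ts[r := act_tape (read_tape (ts ! r), d) (ts ! r)])"
    and "P ! q = WriteI r a \<Longrightarrow> r < 5 \<Longrightarrow> a < 4 \<Longrightarrow>
      tm_step (machine P) (q, ts) = (q + 1, ts[r := act_tape (a, Stay) (ts ! r)])"
    and "P ! q = JumpI r a p p' \<Longrightarrow> r < 5 \<Longrightarrow> p \<le> length P + 1 \<Longrightarrow> p' \<le> length P + 1 \<Longrightarrow>
      tm_step (machine P) (q, ts) = (if read_tape (ts ! r) = a then p else p', ts)"
  using assms
  by (simp_all add: tm_step_def machine_def map2_act_keep map2_act_keep0)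
     (auto simp: keep_def intro!: map2_act_keep)

lemma holds_stacks_update:
  "holds_stacks ts s \<Longrightarrow> holds_stack t xs \<Longrightarrow> r < 5 \<Longrightarrow> holds_stacks (ts[r := t]) (s(r := xs))"
  by (auto simp: holds_stacks_def nth_list_update)

text \<open>The surrounding code \<open>pre\<close> and \<open>post\<close> is arbitrary because a
  subcommand is compiled at the address where it ends up; in the induction, its neighbours move into
  this context.\<close>

lemma compile_correct:
  assumes "exec c s t s'" "P = pre @ compile (length pre) c @ post" "holds_stacks ts s"
  shows "\<exists>n\<le>t. \<exists>ts'. (tm_step (machine P) ^^ n) (length pre, ts) = (length pre + com_size c, ts')
    \<and> holds_stacks ts' s'"
  using assms
proof (induction arbitrary: pre post ts rule: exec.induct)
  case (exec_weaken c s t s' t')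
  from exec_weaken.IH[OF exec_weaken.prems] exec_weaken.hyps show ?case by (meson le_trans)
next
  case (exec_Push r a s)
  have len: "length ts = 5" using exec_Push by (simp add: holds_stacks_def)
  let ?q = "length pre"
  let ?t1 = "act_tape (read_tape (ts ! r), MoveLeft) (ts ! r)"
  have "tm_step (machine P) (?q, ts) = (?q + 1, ts[r := ?t1])"
    using exec_Push len by (intro tm_step_machine(1)) (auto simp: nth_append)
  moreover have "tm_step (machine P) (?q + 1, ts[r := ?t1]) =
      (?q + 1 + 1, (ts[r := ?t1])[r := act_tape (a, Stay) ((ts[r := ?t1]) ! r)])"
    using exec_Push len by (intro tm_step_machine(2)) (auto simp: nth_append)
  ultimately have "(tm_step (machine P) ^^ 2) (?q, ts) = (?q + 2, ts[r := act_tape (a, Stay) ?t1])"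
    using exec_Push len by (simp add: numeral_2_eq_2)
  moreover have "holds_stacks (ts[r := act_tape (a, Stay) ?t1]) (s(r := a # s r))"
    using exec_Push by (intro holds_stacks_update holds_stack_push) (auto simp: holds_stacks_def)
  ultimately show ?case unfolding com_size.simps by blast
next
  case (exec_Pop r s)
  have len: "length ts = 5" using exec_Pop by (simp add: holds_stacks_def)
  let ?q = "length pre"
  let ?t1 = "act_tape (read_tape (ts ! r), MoveRight) (ts ! r)"
  have "tm_step (machine P) (?q, ts) = (?q + 1, ts[r := ?t1])"
    using exec_Pop len by (intro tm_step_machine(1)) (auto simp: nth_append)
  moreover have "holds_stacks (ts[r := ?t1]) (s(r := tl (s r)))"
    using exec_Pop by (intro holds_stacks_update holds_stack_pop) (auto simp: holds_stacks_def)
  ultimately have "(tm_step (machine P) ^^ 1) (?q, ts) = (?q + com_size (Pop r), ts[r := ?t1])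
      \<and> holds_stacks (ts[r := ?t1]) (s(r := tl (s r)))" by simp
  then show ?case by blast
next
  case (exec_Seq c s t s' d t' s'')
  from exec_Seq.IH(1)[of pre "compile (length pre + com_size c) d @ post" ts] exec_Seq.prems
  obtain n ts1 where n: "n \<le> t" "(tm_step (machine P) ^^ n) (length pre, ts) = (length pre + com_size c, ts1)"
    "holds_stacks ts1 s'" by auto
  from exec_Seq.IH(2)[of "pre @ compile (length pre) c" post ts1] exec_Seq.prems n(3)
  obtain m ts2 where m: "m \<le> t'"
    "(tm_step (machine P) ^^ m) (length pre + com_size c, ts1) = (length pre + com_size c + com_size d, ts2)"
    "holds_stacks ts2 s''" by auto
  have "(tm_step (machine P) ^^ (m + n)) (length pre, ts) = (length pre + com_size (c ;; d), ts2)"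
    using n m by (simp add: funpow_add)
  with n m show ?case by (intro exI[of _ "m + n"]) auto
next
  case (exec_Cond_True r s a c t s' d)
  have len: "length ts = 5" using exec_Cond_True by (simp add: holds_stacks_def)
  let ?q = "length pre" and ?e = "length pre + com_size c + com_size d + 2"
  have "read_tape (ts ! r) = a"
    using exec_Cond_True.hyps holds_stacks_read[OF exec_Cond_True.prems(2)] by simp
  moreover have "tm_step (machine P) (?q, ts) =
      (if read_tape (ts ! r) = a then ?q + com_size d + 2 else ?q + 1, ts)"
    using exec_Cond_True len by (intro tm_step_machine(3)) (auto simp: nth_append)
  ultimately have 1: "tm_step (machine P) (?q, ts) = (?q + com_size d + 2, ts)" by simp
  from exec_Cond_True.IH[of "pre @ JumpI r a (?q + com_size d + 2) (?q + 1) # compile (?q + 1) d @ [JumpI 0 0 ?e ?e]" post ts]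
    exec_Cond_True.prems
  obtain n ts1 where n: "n \<le> t" "(tm_step (machine P) ^^ n) (?q + com_size d + 2, ts) = (?e, ts1)"
    "holds_stacks ts1 s'" by (auto simp: algebra_simps)
  have "(tm_step (machine P) ^^ Suc n) (?q, ts) = (?e, ts1)"
    using n 1 by (simp add: funpow_Suc_right del: funpow.simps)
  with n show ?case by (intro exI[of _ "Suc n"]) auto
next
  case (exec_Cond_False r s a d t s' c)
  have len: "length ts = 5" using exec_Cond_False by (simp add: holds_stacks_def)
  let ?q = "length pre" and ?e = "length pre + com_size c + com_size d + 2"
  have "read_tape (ts ! r) \<noteq> a"
    using exec_Cond_False.hyps holds_stacks_read[OF exec_Cond_False.prems(2)] by simp
  moreover have "tm_step (machine P) (?q, ts) =
      (if read_tape (ts ! r) = a then ?q + com_size d + 2 else ?q + 1, ts)"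
    using exec_Cond_False len by (intro tm_step_machine(3)) (auto simp: nth_append)
  ultimately have 1: "tm_step (machine P) (?q, ts) = (?q + 1, ts)" by simp
  from exec_Cond_False.IH[of "pre @ [JumpI r a (?q + com_size d + 2) (?q + 1)]"
      "JumpI 0 0 ?e ?e # compile (?q + com_size d + 2) c @ post" ts]
    exec_Cond_False.prems
  obtain n ts1 where n: "n \<le> t" "(tm_step (machine P) ^^ n) (?q + 1, ts) = (?q + 1 + com_size d, ts1)"
    "holds_stacks ts1 s'" by (auto simp: algebra_simps)
  have "tm_step (machine P) (?q + 1 + com_size d, ts1) = (if read_tape (ts1 ! 0) = 0 then ?e else ?e, ts1)"
    using exec_Cond_False.prems n(3)
    by (intro tm_step_machine(3)) (auto simp: nth_append holds_stacks_def)
  then have "(tm_step (machine P) ^^ Suc (Suc n)) (?q, ts) = (?e, ts1)"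
    using n 1 by (subst funpow.simps, subst o_apply, subst funpow_Suc_right) simp
  with n show ?case by (intro exI[of _ "Suc (Suc n)"]) auto
next
  case (exec_While_end r s a c)
  have len: "length ts = 5" using exec_While_end by (simp add: holds_stacks_def)
  let ?q = "length pre"
  have "read_tape (ts ! r) = a"
    using exec_While_end.hyps holds_stacks_read[OF exec_While_end.prems(2)] by simp
  moreover have "tm_step (machine P) (?q, ts) =
      (if read_tape (ts ! r) = a then ?q + com_size c + 2 else ?q + 1, ts)"
    using exec_While_end len by (intro tm_step_machine(3)) (auto simp: nth_append)
  ultimately show ?case using exec_While_end by (intro exI[of _ 1]) auto
next
  case (exec_While_step r s a c t s' t' s'')
  have len: "length ts = 5" using exec_While_step by (simp add: holds_stacks_def)
  let ?q = "length pre"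
  have "read_tape (ts ! r) \<noteq> a"
    using exec_While_step.hyps holds_stacks_read[OF exec_While_step.prems(2)] by simp
  moreover have "tm_step (machine P) (?q, ts) =
      (if read_tape (ts ! r) = a then ?q + com_size c + 2 else ?q + 1, ts)"
    using exec_While_step len by (intro tm_step_machine(3)) (auto simp: nth_append)
  ultimately have 1: "tm_step (machine P) (?q, ts) = (?q + 1, ts)" by simp
  from exec_While_step.IH(1)[of "pre @ [JumpI r a (?q + com_size c + 2) (?q + 1)]" "JumpI 0 0 ?q ?q # post" ts]
    exec_While_step.prems
  obtain n ts1 where n: "n \<le> t" "(tm_step (machine P) ^^ n) (?q + 1, ts) = (?q + 1 + com_size c, ts1)"
    "holds_stacks ts1 s'" by (auto simp: algebra_simps)
  have 2: "tm_step (machine P) (?q + 1 + com_size c, ts1) = (if read_tape (ts1 ! 0) = 0 then ?q else ?q, ts1)"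
    using exec_While_step.prems n(3)
    by (intro tm_step_machine(3)) (auto simp: nth_append holds_stacks_def)
  then have 3: "(tm_step (machine P) ^^ Suc (Suc n)) (?q, ts) = (?q, ts1)"
    using n 1 by (subst funpow.simps, subst o_apply, subst funpow_Suc_right) simp
  \<comment> \<open>The remaining iterations execute the same command at the same address, so
    \<open>pre\<close> and \<open>post\<close> stay as they are.\<close>
  from exec_While_step.IH(2)[OF exec_While_step.prems(1) n(3)]
  obtain m ts2 where m: "m \<le> t'" "(tm_step (machine P) ^^ m) (?q, ts1) = (?q + com_size (While r a c), ts2)"
    "holds_stacks ts2 s''" by auto
  have "(tm_step (machine P) ^^ (m + Suc (Suc n))) (?q, ts) = (?q + com_size (While r a c), ts2)"
    using 3 m by (simp only: funpow_add o_apply)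
  with n m show ?case by (intro exI[of _ "m + Suc (Suc n)"]) auto
qed

definition input_stacks :: "bool list \<Rightarrow> nat \<Rightarrow> nat list" where
  "input_stacks w = (\<lambda>_. [])(0 := map (\<lambda>b. if b then 2 else 1) w)"

text \<open>\<open>exec\<close> bounds the time only from above, whereas
  \<open>decides_in_time\<close> looks at one fixed moment. Halting configurations are fixed points,
  so stopping early does no harm. The additional step in \<open>p + 1\<close> is the final
  test.\<close>

lemma class_P_I:
  fixes p :: "nat poly"
  assumes "\<And>w. \<exists>s'. exec c (input_stacks w) (poly p (length w)) s' \<and> (peek (s' 0) = 2 \<longleftrightarrow> w \<in> L)"
  shows "L \<in> class_P"
proof -
  define N where "N = com_size c"
  \<comment> \<open>The last jump accepts at address \<open>N + 1\<close>, just behind the program,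
    iff the top of stack 0 is 2, the first symbol of the code of \<open>True\<close>.\<close>
  define P where "P = compile 0 c @ [JumpI 0 2 (N + 1) (N + 2)]"
  define M where "M = machine P"
  have len: "length P = N + 1" by (simp add: P_def N_def)
  have acc: "accept_state M = N + 1" and rej: "reject_state M = N + 2"
    by (simp_all add: M_def machine_def len)
  have "fst ((tm_step M ^^ poly (p + 1) (length w)) (init_config M w)) =
      (if w \<in> L then accept_state M else reject_state M)" for w
  proof -
    obtain s' where s': "exec c (input_stacks w) (poly p (length w)) s'" "peek (s' 0) = 2 \<longleftrightarrow> w \<in> L"
      using assms by blast
    define ts where "ts = input_tape w # replicate 4 blank_tape"
    have "holds_stacks ts (input_stacks w)"
      unfolding holds_stacks_def
    proof (intro conjI allI impI)
      fix r :: nat assume "r < 5"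
      then show "holds_stack (ts ! r) (input_stacks w r)"
        by (cases r) (auto simp: ts_def input_stacks_def holds_stack_def input_tape_def blank_tape_def)
    qed (simp add: ts_def)
    from compile_correct[OF s'(1), of P "[]" _ ts] this
    obtain n ts' where n: "n \<le> poly p (length w)" "(tm_step M ^^ n) (0, ts) = (N, ts')" "holds_stacks ts' s'"
      by (auto simp: P_def M_def N_def)
    have "length ts' = 5" "read_tape (ts' ! 0) = peek (s' 0)"
      using n(3) by (simp_all add: holds_stacks_def holds_stack_read)
    then have "tm_step M (N, ts') = (if w \<in> L then N + 1 else N + 2, ts')"
      using s'(2) tm_step_machine(3)[of N P ts' 0 2 "N + 1" "N + 2"] len
      by (auto simp: M_def P_def nth_append N_def)
    then have S: "(tm_step M ^^ Suc n) (init_config M w) = (if w \<in> L then N + 1 else N + 2, ts')"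
      using n(2) by (simp add: init_config_def M_def machine_def ts_def)
    have halt: "(tm_step M ^^ k) (if w \<in> L then N + 1 else N + 2, ts') = (if w \<in> L then N + 1 else N + 2, ts')" for k
      by (induction k) (auto simp: tm_step_def acc rej)
    obtain k where k: "poly (p + 1) (length w) = k + Suc n"
      using n(1) by (metis Suc_eq_plus1 add.commute le_add_diff_inverse2 Suc_le_mono poly_add poly_1)
    show ?thesis unfolding k by (simp only: funpow_add o_apply S halt) (auto simp: acc rej)
  qed
  then have "wf_tm M \<and> decides_in_time M L (poly (p + 1))"
    using wf_machine by (auto simp: decides_in_time_def M_def)
  then show ?thesis unfolding class_P_def by blast
qed


section \<open>Trees on stacks\<close>

datatype tree = Leaf | Node tree tree

text \<open>Prefix notation is self-delimiting, so a tree can lie on top of other data without a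
  separator, and its top symbol alone tells whether it is a leaf.\<close>

fun code :: "tree \<Rightarrow> nat list" where
  "code Leaf = [1]"
| "code (Node a b) = 2 # code a @ code b"

lemma set_code: "set (code x) \<subseteq> {1, 2}"
  by (induction x) auto

lemma exec_eq: "exec c s t s'' \<Longrightarrow> s'' = s' \<Longrightarrow> t \<le> t' \<Longrightarrow> exec c s t' s'"
  using exec_weaken by blast

text \<open>The continuation is a premise, so straight-line code is executed symbolically by
  applying such rules repeatedly.\<close>

lemma run_Push: "r < 5 \<Longrightarrow> a < 4 \<Longrightarrow> exec c (s(r := a # s r)) t s' \<Longrightarrow> exec (Push r a ;; c) s (2 + t) s'"
  by (rule exec_Seq[OF exec_Push])

lemma run_Pop: "r < 5 \<Longrightarrow> exec c (s(r := tl (s r))) t s' \<Longrightarrow> exec (Pop r ;; c) s (1 + t) s'"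
  by (rule exec_Seq[OF exec_Pop])

text \<open>\<open>scan_loop i\<close> reads symbols off stack \<open>i\<close>, with the number of trees still to be read in
  unary on stack 3, and leaves two reversed copies.\<close>

definition scan_loop :: "nat \<Rightarrow> com" where
  "scan_loop i = While 3 3 (Cond i 2
     (Push 3 2 ;; Push 1 2 ;; Push 2 2 ;; Pop i)
     (Pop 3 ;; Push 1 1 ;; Push 2 1 ;; Pop i))"

text \<open>The markers 3 allow all auxiliary stacks to be nonempty beforehand: both copies and the
  counter sit on top of whatever is there. The single 2 says that one tree is pending.\<close>

definition scan :: "nat \<Rightarrow> com" where
  "scan i = Push 1 3 ;; Push 2 3 ;; Push 3 3 ;; Push 3 2 ;; scan_loop i ;; Pop 3"

text \<open>The loop does not stop after a tree while others are pending. Hence the claim prefixes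
  the reading of \<open>x\<close> to an arbitrary run that starts afterwards; for a node, the
  hypotheses for both subtrees are chained. A symbol costs at most 11: 7 for the longer branch and 2
  for each of the two tests.\<close>

lemma exec_scan_loop:
  assumes "i = 0 \<or> i = 4" "s i = code x @ R" "s 3 = 2 # K"
    "exec (scan_loop i) (s(i := R, 3 := K, 1 := rev (code x) @ s 1, 2 := rev (code x) @ s 2)) t s'"
  shows "exec (scan_loop i) s (t + 11 * length (code x)) s'"
  using assms
proof (induction x arbitrary: s R K t)
  case Leaf
  have "exec (Pop 3 ;; Push 1 1 ;; Push 2 1 ;; Pop i) s 6
      (s(i := R, 3 := K, 1 := rev (code Leaf) @ s 1, 2 := rev (code Leaf) @ s 2))"
    apply (rule exec_eq)
      apply (rule run_Pop run_Push exec_Pop; use Leaf in simp)+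
    using Leaf by (auto simp: fun_eq_iff)
  then have "exec (Cond i 2 (Push 3 2 ;; Push 1 2 ;; Push 2 2 ;; Pop i) (Pop 3 ;; Push 1 1 ;; Push 2 1 ;; Pop i)) s (6 + 2)
      (s(i := R, 3 := K, 1 := rev (code Leaf) @ s 1, 2 := rev (code Leaf) @ s 2))"
    using Leaf by - (rule exec_Cond_False[rotated 2], assumption, auto)
  from exec_While_step[OF _ _ this Leaf(4)[unfolded scan_loop_def]] Leaf
  show ?case unfolding scan_loop_def by (auto elim!: exec_weaken)
next
  case (Node x y)
  define s1 where "s1 = s(i := code x @ code y @ R, 3 := 2 # 2 # K, 1 := 2 # s 1, 2 := 2 # s 2)"
  have "exec (Push 3 2 ;; Push 1 2 ;; Push 2 2 ;; Pop i) s 7 s1"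
    apply (rule exec_eq)
      apply (rule run_Pop run_Push exec_Pop; use Node.prems in simp)+
    using Node.prems by (auto simp: fun_eq_iff s1_def)
  then have 1: "exec (Cond i 2 (Push 3 2 ;; Push 1 2 ;; Push 2 2 ;; Pop i) (Pop 3 ;; Push 1 1 ;; Push 2 1 ;; Pop i)) s (7 + 2) s1"
    using Node.prems by - (rule exec_Cond_True[rotated 2], assumption, auto)
  have "exec (scan_loop i) s1 ((t + 11 * length (code y)) + 11 * length (code x)) s'"
  proof (rule Node.IH(1))
    show "exec (scan_loop i) (s1(i := code y @ R, 3 := 2 # K, 1 := rev (code x) @ s1 1, 2 := rev (code x) @ s1 2))
        (t + 11 * length (code y)) s'"
    proof (rule Node.IH(2))
      show "exec (scan_loop i) (s1(i := code y @ R, 3 := 2 # K, 1 := rev (code x) @ s1 1, 2 := rev (code x) @ s1 2,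
          i := R, 3 := K,
          1 := rev (code y) @ (s1(i := code y @ R, 3 := 2 # K, 1 := rev (code x) @ s1 1, 2 := rev (code x) @ s1 2)) 1,
          2 := rev (code y) @ (s1(i := code y @ R, 3 := 2 # K, 1 := rev (code x) @ s1 1, 2 := rev (code x) @ s1 2)) 2)) t s'"
        by (rule back_subst[of "\<lambda>u. exec (scan_loop i) u t s'", OF Node.prems(4)])
           (use Node.prems in \<open>auto simp: s1_def fun_eq_iff\<close>)
    qed (use Node.prems in \<open>auto simp: s1_def\<close>)
  qed (use Node.prems in \<open>auto simp: s1_def\<close>)
  from exec_While_step[OF _ _ 1 this[unfolded scan_loop_def]] Node.prems
  show ?case unfolding scan_loop_def by (auto elim!: exec_weaken)
qed

lemma exec_scan:
  assumes "i = 0 \<or> i = 4" "s i = code x @ R"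
  shows "exec (scan i) s (11 * length (code x) + 10)
     (s(i := R, 1 := rev (code x) @ 3 # s 1, 2 := rev (code x) @ 3 # s 2))"
proof -
  let ?s = "s(1 := 3 # s 1, 2 := 3 # s 2, 3 := 2 # 3 # s 3)"
  have "exec (scan_loop i) (?s(i := R, 3 := 3 # s 3, 1 := rev (code x) @ ?s 1, 2 := rev (code x) @ ?s 2)) 1
      (s(i := R, 1 := rev (code x) @ 3 # s 1, 2 := rev (code x) @ 3 # s 2, 3 := 3 # s 3))"
    unfolding scan_loop_def
    by (rule exec_eq, rule exec_While_end) (use assms in \<open>auto simp: fun_eq_iff\<close>)
  from exec_scan_loop[OF assms(1) _ _ this] assms
  have 1: "exec (scan_loop i) ?s (1 + 11 * length (code x))
      (s(i := R, 1 := rev (code x) @ 3 # s 1, 2 := rev (code x) @ 3 # s 2, 3 := 3 # s 3))"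
    by auto
  have 2: "exec (scan_loop i ;; Pop 3) ?s ((1 + 11 * length (code x)) + 1)
      (s(i := R, 1 := rev (code x) @ 3 # s 1, 2 := rev (code x) @ 3 # s 2))"
    by (rule exec_eq, rule exec_Seq[OF 1 exec_Pop]) (use assms in \<open>auto simp: fun_eq_iff\<close>)
  have 3: "s(1 := 3 # s 1, 2 := 3 # (s(1 := 3 # s 1)) 2,
       3 := 3 # (s(1 := 3 # s 1, 2 := 3 # (s(1 := 3 # s 1)) 2)) 3,
       3 := 2 # (s(1 := 3 # s 1, 2 := 3 # (s(1 := 3 # s 1)) 2,
       3 := 3 # (s(1 := 3 # s 1, 2 := 3 # (s(1 := 3 # s 1)) 2)) 3)) 3) = ?s"
    by (auto simp: fun_eq_iff)
  show ?thesis
    unfolding scan_def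
    apply (rule exec_eq)
      apply (rule run_Push, simp, simp)+
      apply (subst 3)
      apply (rule 2)
     apply simp
    apply simp
    done
qed

definition unload :: "nat \<Rightarrow> nat \<Rightarrow> com" where
  "unload j i = While j 3 (Cond j 2 (Push i 2) (Push i 1) ;; Pop j) ;; Pop j"

lemma exec_unload:
  assumes "i < 5" "j < 5" "i \<noteq> j" "set xs \<subseteq> {1, 2}" "s j = xs @ 3 # R"
  shows "exec (unload j i) s (7 * length xs + 2) (s(j := R, i := rev xs @ s i))"
proof -
  have "exec (While j 3 (Cond j 2 (Push i 2) (Push i 1) ;; Pop j)) s (7 * length xs + 1)
      (s(j := 3 # R, i := rev xs @ s i))"
    using assms
  proof (induction xs arbitrary: s)
    case Nil
    show ?case
      by (rule exec_eq, rule exec_While_end) (use Nil in \<open>auto simp: fun_eq_iff\<close>)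
  next
    case (Cons x xs)
    have "exec (Cond j 2 (Push i 2) (Push i 1)) s 4 (s(i := x # s i))"
    proof (cases "x = 2")
      case True
      show ?thesis by (rule exec_eq, rule exec_Cond_True, simp_all add: Cons.prems True)
         (rule exec_eq, rule exec_Push, use Cons.prems True in auto)
    next
      case False
      then have "x = 1" using Cons.prems by auto
      show ?thesis by (rule exec_eq, rule exec_Cond_False, simp_all add: Cons.prems False)
         (rule exec_eq, rule exec_Push, use Cons.prems \<open>x = 1\<close> in auto)
    qed
    then have 1: "exec (Cond j 2 (Push i 2) (Push i 1) ;; Pop j) s (4 + 1)
        ((s(i := x # s i))(j := tl ((s(i := x # s i)) j)))"
      by (rule exec_Seq) (rule exec_Pop, rule Cons.prems)
    have "exec (While j 3 (Cond j 2 (Push i 2) (Push i 1) ;; Pop j))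
        ((s(i := x # s i))(j := tl ((s(i := x # s i)) j))) (7 * length xs + 1)
        (s(j := 3 # R, i := rev (x # xs) @ s i))"
      by (rule exec_eq, rule Cons.IH) (use Cons.prems in \<open>auto simp: fun_eq_iff\<close>)
    note w = exec_While_step[OF _ _ 1 this]
    show ?case by (rule exec_weaken, rule w) (use Cons.prems in auto)
  qed
  from exec_Seq[OF this exec_Pop[of j]] assms
  show ?thesis unfolding unload_def by (auto elim!: exec_eq simp: fun_eq_iff)
qed

definition clear :: "nat \<Rightarrow> com" where
  "clear j = While j 3 (Pop j) ;; Pop j"

lemma exec_clear:
  assumes "j < 5" "set xs \<subseteq> {1, 2}" "s j = xs @ 3 # R"
  shows "exec (clear j) s (3 * length xs + 2) (s(j := R))"
proof -
  have "exec (While j 3 (Pop j)) s (3 * length xs + 1) (s(j := 3 # R))"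
    using assms
  proof (induction xs arbitrary: s)
    case Nil
    show ?case
      by (rule exec_eq, rule exec_While_end) (use Nil in \<open>auto simp: fun_eq_iff\<close>)
  next
    case (Cons x xs)
    have "exec (While j 3 (Pop j)) (s(j := tl (s j))) (3 * length xs + 1) (s(j := 3 # R))"
      by (rule exec_eq, rule Cons.IH) (use Cons.prems in \<open>auto simp: fun_eq_iff\<close>)
    note w = exec_While_step[OF _ _ exec_Pop this]
    show ?case by (rule exec_weaken, rule w) (use Cons.prems in auto)
  qed
  from exec_Seq[OF this exec_Pop[of j]] assms
  show ?thesis unfolding clear_def by (auto elim!: exec_eq simp: fun_eq_iff)
qed

text \<open>Reading a tree removes it and leaves two reversed copies; unloading a copy reverses it
  back. The four operations differ only in where each copy goes. Their common cost 25 per symbol is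
  11 for reading and 7 for each of two unloadings.\<close>

definition "duplicate = scan 0 ;; unload 1 0 ;; unload 2 0"
definition "discard = scan 0 ;; clear 1 ;; clear 2"
definition "save = scan 0 ;; unload 1 4 ;; clear 2"
definition "restore = scan 4 ;; unload 1 0 ;; clear 2"

lemma set_rev_code: "set (rev (code x)) \<subseteq> {1, 2}"
  using set_code by simp

lemma exec_duplicate:
  assumes "s 0 = code x @ R"
  shows "exec duplicate s (25 * length (code x) + 14) (s(0 := code x @ code x @ R))"
  unfolding duplicate_def
  by (rule exec_eq, rule exec_Seq[OF exec_scan exec_Seq[OF exec_unload exec_unload]],
      use assms set_rev_code in \<open>auto simp: fun_eq_iff\<close>)

lemma exec_discard:
  assumes "s 0 = code x @ R"
  shows "exec discard s (25 * length (code x) + 14) (s(0 := R))"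
  unfolding discard_def
  by (rule exec_eq, rule exec_Seq[OF exec_scan exec_Seq[OF exec_clear exec_clear]],
      use assms set_rev_code in \<open>auto simp: fun_eq_iff\<close>)

lemma exec_save:
  assumes "s 0 = code x @ R"
  shows "exec save s (25 * length (code x) + 14) (s(0 := R, 4 := code x @ s 4))"
  unfolding save_def
  by (rule exec_eq, rule exec_Seq[OF exec_scan exec_Seq[OF exec_unload exec_clear]],
      use assms set_rev_code in \<open>auto simp: fun_eq_iff\<close>)

lemma exec_restore:
  assumes "s 4 = code x @ R"
  shows "exec restore s (25 * length (code x) + 14) (s(4 := R, 0 := code x @ s 0))"
  unfolding restore_def
  by (rule exec_eq, rule exec_Seq[OF exec_scan exec_Seq[OF exec_unload exec_clear]],
      use assms set_rev_code in \<open>auto simp: fun_eq_iff\<close>)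


section \<open>Functions computable in polynomial time\<close>

text \<open>Trees carry no type tags: the empty list, \<open>None\<close>, \<open>False\<close> and
  \<open>()\<close> are all leaves, and a list cell looks like a pair. Changes of type are therefore
  free, and one branching construct serves all case distinctions.\<close>

class data =
  fixes tree_of :: "'a \<Rightarrow> tree"

instantiation unit :: data begin
definition "tree_of (u :: unit) = Leaf"
instance ..
end

instantiation bool :: data begin
definition "tree_of b = (if b then Node Leaf Leaf else Leaf)"
instance ..
end

instantiation prod :: (data, data) data begin
definition "tree_of p = Node (tree_of (fst p)) (tree_of (snd p))"
instance ..
end

instantiation list :: (data) data begin
primrec tree_of_list :: "'a list \<Rightarrow> tree" where
  "tree_of_list [] = Leaf"
| "tree_of_list (x # xs) = Node (tree_of x) (tree_of_list xs)"
instance ..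
end

instantiation option :: (data) data begin
definition "tree_of z = (case z of None \<Rightarrow> Leaf | Some x \<Rightarrow> Node (tree_of x) Leaf)"
instance ..
end

definition dsize :: "'a::data \<Rightarrow> nat" where
  "dsize x = length (code (tree_of x))"

lemma dsize_simps [simp]:
  "dsize (u :: unit) = 1"
  "dsize True = 3" "dsize False = 1"
  "dsize (x, y) = dsize x + dsize y + 1"
  "dsize [] = 1" "dsize (x # xs) = dsize x + dsize xs + 1"
  "dsize None = 1" "dsize (Some x) = dsize x + 2"
  by (simp_all add: dsize_def tree_of_unit_def tree_of_bool_def tree_of_prod_def tree_of_option_def)

lemma dsize_bool_le: "dsize (b :: bool) \<le> 3"
  by (cases b) auto

lemma code_pos: "0 < length (code t)"
  by (cases t) auto

lemma dsize_pos [simp]: "0 < dsize x"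
  unfolding dsize_def by (rule code_pos)

lemma dsize_pos' [simp]: "Suc 0 \<le> dsize x"
  using dsize_pos[of x] by linarith

lemma length_le_dsize: "length xs \<le> dsize xs"
  by (induction xs) auto

lemma dsize_append: "dsize (xs @ ys) + 1 = dsize xs + dsize ys"
  by (induction xs) auto

lemma dsize_list_le:
  "(\<And>x. x \<in> set xs \<Longrightarrow> dsize x \<le> B) \<Longrightarrow> length xs \<le> N \<Longrightarrow> dsize xs \<le> 1 + N * (B + 1)"
proof (induction xs arbitrary: N)
  case (Cons x xs)
  then obtain N' where N: "N = Suc N'" by (cases N) auto
  have "dsize xs \<le> 1 + N' * (B + 1)" "dsize x \<le> B"
    using Cons N by auto
  then show ?case by (simp add: N)
qed simp

lemma dsize_elem_le: "x \<in> set xs \<Longrightarrow> dsize x \<le> dsize xs"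
  by (induction xs) auto

lemma dsize_bools: "dsize (xs :: bool list) \<le> 4 * length xs + 1"
  using dsize_list_le[of xs 3 "length xs"] dsize_bool_le by auto


section \<open>Polynomially bounded quantities\<close>

lemma poly_nat_mono: "x \<le> y \<Longrightarrow> poly p x \<le> poly p y" for p :: "nat poly"
  by (induction p) (auto intro!: add_mono mult_mono)

text \<open>The bounded quantity may depend on the whole argument and not just on its size, so costs
  and result sizes share the same closure rules. Natural coefficients make polynomials monotone,
  which is what substituting one bound into another requires.\<close>

definition pbounded :: "('a::data \<Rightarrow> nat) \<Rightarrow> bool" where
  "pbounded h \<longleftrightarrow> (\<exists>p :: nat poly. \<forall>x. h x \<le> poly p (dsize x))"

lemma pbounded_mono: "pbounded h \<Longrightarrow> (\<And>x. h' x \<le> h x) \<Longrightarrow> pbounded h'"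
  unfolding pbounded_def by (meson le_trans)

lemma pbounded_const: "pbounded (\<lambda>_. n)"
  unfolding pbounded_def by (rule exI[of _ "[:n:]"]) simp

lemma pbounded_dsize: "pbounded dsize"
  unfolding pbounded_def by (rule exI[of _ "[:0, 1:]"]) simp

lemma pbounded_add: "pbounded g \<Longrightarrow> pbounded h \<Longrightarrow> pbounded (\<lambda>x. g x + h x)"
  unfolding pbounded_def
  apply (elim exE)
  subgoal for p q by (rule exI[of _ "p + q"]) (auto intro: add_mono)
  done

lemma pbounded_mult: "pbounded g \<Longrightarrow> pbounded h \<Longrightarrow> pbounded (\<lambda>x. g x * h x)"
  unfolding pbounded_def
  apply (elim exE)
  subgoal for p q by (rule exI[of _ "p * q"]) (auto intro: mult_mono)
  done

lemma pbounded_poly: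
  fixes p :: "nat poly"
  assumes "pbounded h"
  shows "pbounded (\<lambda>x. poly p (h x))"
proof -
  obtain q where "\<And>x. h x \<le> poly q (dsize x)" using assms unfolding pbounded_def by blast
  then have "poly p (h x) \<le> poly (pcompose p q) (dsize x)" for x
    by (auto simp: poly_pcompose intro: poly_nat_mono)
  then show ?thesis unfolding pbounded_def by blast
qed

lemma pbounded_comp:
  assumes "pbounded h" "pbounded (\<lambda>x. dsize (g x))"
  shows "pbounded (\<lambda>x. h (g x))"
proof -
  obtain p where "\<And>y. h y \<le> poly p (dsize y)" using assms(1) unfolding pbounded_def by blast
  then show ?thesis by (rule pbounded_mono[OF pbounded_poly[OF assms(2)]])
qed

lemma pbounded_Suc: "pbounded h \<Longrightarrow> pbounded (\<lambda>x. Suc (h x))"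
  using pbounded_add[OF _ pbounded_const[of 1]] by simp

lemmas pbounded_intros = pbounded_const pbounded_Suc pbounded_dsize pbounded_add pbounded_mult pbounded_poly


text \<open>A frame condition is built in: \<open>R\<close> and the other four stacks come back
  unchanged, so a program can run while saved data lie underneath or on stack 4.\<close>

definition computes :: "com \<Rightarrow> ('a::data \<Rightarrow> 'b::data) \<Rightarrow> ('a \<Rightarrow> nat) \<Rightarrow> bool" where
  "computes c f b \<longleftrightarrow> (\<forall>s x R. s 0 = code (tree_of x) @ R \<longrightarrow> exec c s (b x) (s(0 := code (tree_of (f x)) @ R)))"

text \<open>The size of the result is bounded separately because composition evaluates the second
  time bound at the intermediate result.\<close>

definition ptime :: "('a::data \<Rightarrow> 'b::data) \<Rightarrow> bool" where
  "ptime f \<longleftrightarrow> (\<exists>c b. computes c f b \<and> pbounded b \<and> pbounded (\<lambda>x. dsize (f x)))"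

lemma computesI:
  "(\<And>s x R. s 0 = code (tree_of x) @ R \<Longrightarrow> exec c s (b x) (s(0 := code (tree_of (f x)) @ R))) \<Longrightarrow> computes c f b"
  by (simp add: computes_def)

lemma computesD:
  "computes c f b \<Longrightarrow> s 0 = code (tree_of x) @ R \<Longrightarrow> exec c s (b x) (s(0 := code (tree_of (f x)) @ R))"
  by (simp add: computes_def)

lemma ptimeI: "computes c f b \<Longrightarrow> pbounded b \<Longrightarrow> pbounded (\<lambda>x. dsize (f x)) \<Longrightarrow> ptime f"
  unfolding ptime_def by blast

lemma ptime_pbounded: "ptime f \<Longrightarrow> pbounded (\<lambda>x. dsize (f x))"
  unfolding ptime_def by blast

lemma ptime_cong: "ptime f \<Longrightarrow> (\<And>x. g x = f x) \<Longrightarrow> ptime g"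
  by (simp only: ext[of g f])

lemma computes_comp:
  fixes f :: "'a::data \<Rightarrow> 'b::data" and g :: "'b \<Rightarrow> 'c::data"
  assumes "computes c f b" "computes d g b'"
  shows "computes (c ;; d) (\<lambda>x. g (f x)) (\<lambda>x. b x + b' (f x))"
proof (rule computesI)
  fix s :: "nat \<Rightarrow> nat list" and x :: 'a and R assume *: "s 0 = code (tree_of x) @ R"
  show "exec (c ;; d) s (b x + b' (f x)) (s(0 := code (tree_of (g (f x))) @ R))"
    by (rule exec_eq, rule exec_Seq[OF computesD[OF assms(1), of s, OF *] computesD[OF assms(2)]]) auto
qed

lemma ptime_comp:
  assumes "ptime f" "ptime g"
  shows "ptime (\<lambda>x. g (f x))"
proof -
  obtain c b d b' where c: "computes c f b" "pbounded b" "pbounded (\<lambda>x. dsize (f x))"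
    and d: "computes d g b'" "pbounded b'" "pbounded (\<lambda>x. dsize (g x))"
    using assms unfolding ptime_def by blast
  show ?thesis
    by (rule ptimeI[OF computes_comp[OF c(1) d(1)]])
       (intro pbounded_intros c pbounded_comp[OF d(2)] pbounded_comp[OF d(3)])+
qed

text \<open>Covers the identity as well as a mere change of type, as from a pair to a list cell.\<close>

lemma ptime_recode:
  fixes f :: "'a::data \<Rightarrow> 'b::data"
  assumes "\<And>x. tree_of (f x) = tree_of x"
  shows "ptime f"
proof (rule ptimeI)
  \<comment> \<open>The language has no empty command; a push and a pop take its place.\<close>
  show "computes (Push 0 1 ;; Pop 0) f (\<lambda>_. 3)"
  proof (rule computesI)
    fix s :: "nat \<Rightarrow> nat list" and x :: 'a and R assume *: "s 0 = code (tree_of x) @ R"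
    show "exec (Push 0 1 ;; Pop 0) s 3 (s(0 := code (tree_of (f x)) @ R))"
      by (rule exec_eq, rule run_Push, simp, simp, rule exec_Pop) (auto simp: assms * fun_eq_iff)
  qed
  have "dsize (f x) = dsize x" for x by (simp add: dsize_def assms)
  then show "pbounded (\<lambda>x. dsize (f x))" by (simp add: pbounded_dsize)
qed (rule pbounded_const)

lemma ptime_id: "ptime (\<lambda>x. x)"
  by (rule ptime_recode) simp

lemma exec_fst:
  assumes "s 0 = 2 # code t @ code u @ R"
  shows "exec (Pop 0 ;; save ;; discard ;; restore) s (50 * length (code t) + 25 * length (code u) + 43)
    (s(0 := code t @ R))"
proof -
  let ?s0 = "s(0 := tl (s 0))"
  let ?s1 = "?s0(0 := code u @ R, 4 := code t @ ?s0 4)"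
  let ?s2 = "?s1(0 := R)"
  have 1: "exec save ?s0 (25 * length (code t) + 14) ?s1" by (rule exec_save) (use assms in auto)
  have 2: "exec discard ?s1 (25 * length (code u) + 14) ?s2" by (rule exec_discard) auto
  have 3: "exec restore ?s2 (25 * length (code t) + 14) (?s2(4 := s 4, 0 := code t @ ?s2 0))"
    by (rule exec_restore) auto
  show ?thesis
    by (rule exec_eq, rule exec_Seq[OF exec_Pop exec_Seq[OF 1 exec_Seq[OF 2 3]]]) (auto simp: fun_eq_iff)
qed

lemma ptime_fst0: "ptime (fst :: 'a::data \<times> 'b::data \<Rightarrow> 'a)"
proof (rule ptimeI)
  show "computes (Pop 0 ;; save ;; discard ;; restore) (fst :: 'a \<times> 'b \<Rightarrow> 'a) (\<lambda>p. 75 * dsize p + 43)"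
    by (rule computesI, rule exec_eq, rule exec_fst) (auto simp: tree_of_prod_def dsize_def)
  show "pbounded (\<lambda>p :: 'a \<times> 'b. dsize (fst p))"
    by (rule pbounded_mono[OF pbounded_dsize]) (auto simp: split_paired_all)
qed (intro pbounded_intros)

lemma ptime_snd0: "ptime (snd :: 'a::data \<times> 'b::data \<Rightarrow> 'b)"
proof (rule ptimeI)
  show "computes (Pop 0 ;; discard) (snd :: 'a \<times> 'b \<Rightarrow> 'b) (\<lambda>p. 25 * dsize p + 15)"
  proof (rule computesI)
    fix s :: "nat \<Rightarrow> nat list" and x :: "'a \<times> 'b" and R
    assume *: "s 0 = code (tree_of x) @ R"
    have "exec discard (s(0 := tl (s 0))) (25 * length (code (tree_of (fst x))) + 14)
      (s(0 := tl (s 0), 0 := code (tree_of (snd x)) @ R))"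
      by (rule exec_discard) (use * in \<open>simp add: tree_of_prod_def\<close>)
    then show "exec (Pop 0 ;; discard) s (25 * dsize x + 15) (s(0 := code (tree_of (snd x)) @ R))"
      by - (rule exec_eq, rule run_Pop, simp, assumption, auto simp: dsize_def tree_of_prod_def)
  qed
  show "pbounded (\<lambda>p :: 'a \<times> 'b. dsize (snd p))"
    by (rule pbounded_mono[OF pbounded_dsize]) (auto simp: split_paired_all)
qed (intro pbounded_intros)

text \<open>One copy of the argument is consumed by \<open>c\<close>, whose result waits on stack 4
  while \<open>d\<close> consumes the other. Restoring it puts the first component above the second,
  and a final 2 makes them a node.\<close>

lemma computes_Pair:
  fixes f :: "'a::data \<Rightarrow> 'b::data" and g :: "'a \<Rightarrow> 'c::data"
  assumes "computes c f b" "computes d g b'"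
  shows "computes (duplicate ;; c ;; save ;; d ;; restore ;; Push 0 2) (\<lambda>x. (f x, g x))
    (\<lambda>x. 25 * dsize x + b x + 50 * dsize (f x) + b' x + 44)"
proof (rule computesI)
  fix s :: "nat \<Rightarrow> nat list" and x :: 'a and R assume *: "s 0 = code (tree_of x) @ R"
  let ?s1 = "s(0 := code (tree_of x) @ code (tree_of x) @ R)"
  let ?s2 = "?s1(0 := code (tree_of (f x)) @ code (tree_of x) @ R)"
  let ?s3 = "?s2(0 := code (tree_of x) @ R, 4 := code (tree_of (f x)) @ ?s2 4)"
  let ?s4 = "?s3(0 := code (tree_of (g x)) @ R)"
  let ?s5 = "?s4(4 := s 4, 0 := code (tree_of (f x)) @ ?s4 0)"
  have 1: "exec duplicate s (25 * dsize x + 14) ?s1" using exec_duplicate[of s, OF *] by (simp add: dsize_def)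
  have 2: "exec c ?s1 (b x) ?s2" by (rule computesD[OF assms(1)]) simp
  have 3: "exec save ?s2 (25 * dsize (f x) + 14) ?s3" unfolding dsize_def by (rule exec_save) simp
  have 4: "exec d ?s3 (b' x) ?s4" by (rule computesD[OF assms(2)]) simp
  have 5: "exec restore ?s4 (25 * dsize (f x) + 14) ?s5" unfolding dsize_def by (rule exec_restore) simp
  show "exec (duplicate ;; c ;; save ;; d ;; restore ;; Push 0 2) s
      (25 * dsize x + b x + 50 * dsize (f x) + b' x + 44) (s(0 := code (tree_of (f x, g x)) @ R))"
    by (rule exec_eq, rule exec_Seq[OF 1 exec_Seq[OF 2 exec_Seq[OF 3 exec_Seq[OF 4 exec_Seq[OF 5 exec_Push]]]]])
       (auto simp: tree_of_prod_def fun_eq_iff)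
qed

lemma ptime_Pair:
  assumes "ptime f" "ptime g"
  shows "ptime (\<lambda>x. (f x, g x))"
proof -
  obtain c b d b' where c: "computes c f b" "pbounded b" "pbounded (\<lambda>x. dsize (f x))"
    and d: "computes d g b'" "pbounded b'" "pbounded (\<lambda>x. dsize (g x))"
    using assms unfolding ptime_def by blast
  show ?thesis
    by (rule ptimeI[OF computes_Pair[OF c(1) d(1)]]; (subst dsize_simps)?; intro pbounded_intros c d)
qed

fun push_list :: "nat list \<Rightarrow> com" where
  "push_list [] = Push 0 1 ;; Pop 0"
| "push_list (a # xs) = push_list xs ;; Push 0 a"

lemma exec_push_list:
  "set xs \<subseteq> {1, 2} \<Longrightarrow> exec (push_list xs) s (2 * length xs + 3) (s(0 := xs @ s 0))"
proof (induction xs)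
  case Nil
  show ?case
    unfolding push_list.simps by (rule exec_eq, rule run_Push, simp, simp, rule exec_Pop) (auto simp: fun_eq_iff)
next
  case (Cons x xs)
  then have "set xs \<subseteq> {1, 2}" "x < 4" by auto
  note IH = Cons.IH[OF this(1)]
  show ?case
    unfolding push_list.simps
    by (rule exec_eq, rule exec_Seq[OF IH exec_Push]) (use \<open>x < 4\<close> in \<open>auto simp: fun_eq_iff\<close>)
qed

lemma ptime_const: "ptime (\<lambda>x :: 'a::data. y :: 'b::data)"
proof (rule ptimeI)
  show "computes (discard ;; push_list (code (tree_of y))) (\<lambda>x :: 'a. y) (\<lambda>x. 25 * dsize x + 2 * dsize y + 17)"
  proof (rule computesI)
    fix s :: "nat \<Rightarrow> nat list" and x :: 'a and R assume *: "s 0 = code (tree_of x) @ R"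
    show "exec (discard ;; push_list (code (tree_of y))) s (25 * dsize x + 2 * dsize y + 17) (s(0 := code (tree_of y) @ R))"
      by (rule exec_eq, rule exec_Seq[OF exec_discard[of s, OF *] exec_push_list[OF set_code]])
         (auto simp: fun_eq_iff dsize_def)
  qed
qed (intro pbounded_intros)+

text \<open>Removing the root of the pair \<open>(g s, s)\<close> exposes the first symbol of
  \<open>g s\<close>. If it is 1, popping it leaves \<open>s\<close> for \<open>A\<close>; otherwise
  the root is put back, and \<open>B\<close> receives the same tree read as a pair
  \<open>(v, s)\<close>. The type of \<open>v\<close> may differ from that of \<open>g s\<close>;
  only the trees agree.\<close>

lemma ptime_branch:
  fixes g :: "'s::data \<Rightarrow> 'b::data" and B :: "'v::data \<times> 's \<Rightarrow> 'r::data"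
  assumes "ptime g" "ptime A" "ptime B"
    and h: "\<And>s. tree_of (g s) = Leaf \<and> h s = A s \<or> (\<exists>v. tree_of (g s) = tree_of v \<and> tree_of v \<noteq> Leaf \<and> h s = B (v, s))"
  shows "ptime h"
proof -
  obtain c bc where c: "computes c (\<lambda>s. (g s, s)) bc" "pbounded bc" "pbounded (\<lambda>s. dsize (g s, s))"
    using ptime_Pair[OF assms(1) ptime_id] unfolding ptime_def by blast
  obtain a ba where a: "computes a A ba" "pbounded ba" "pbounded (\<lambda>s. dsize (A s))"
    using assms(2) unfolding ptime_def by blast
  obtain d bd where d: "computes d B bd" "pbounded bd" "pbounded (\<lambda>s. dsize (B s))"
    using assms(3) unfolding ptime_def by blast
  obtain p q where p: "\<And>z. bd z \<le> poly p (dsize z)" and q: "\<And>z. dsize (B z) \<le> poly q (dsize z)"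
    using d unfolding pbounded_def by blast
  let ?b = "\<lambda>s. bc s + ba s + poly p (dsize (g s, s)) + 7"
  have "computes (c ;; Pop 0 ;; Cond 0 1 (Pop 0 ;; a) (Push 0 2 ;; d)) h ?b"
  proof (rule computesI)
    fix s :: "nat \<Rightarrow> nat list" and x :: 's and R assume *: "s 0 = code (tree_of x) @ R"
    let ?s1 = "s(0 := code (tree_of (g x, x)) @ R)"
    let ?s2 = "?s1(0 := tl (?s1 0))"
    have 1: "exec c s (bc x) ?s1" by (rule computesD[OF c(1), of s, OF *])
    have "exec (Cond 0 1 (Pop 0 ;; a) (Push 0 2 ;; d)) ?s2 (ba x + poly p (dsize (g x, x)) + 6)
        (s(0 := code (tree_of (h x)) @ R))"
    proof (cases "tree_of (g x) = Leaf")
      case True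
      then have "h x = A x" using h[of x] by auto
      have "exec (Pop 0 ;; a) ?s2 (1 + ba x) (?s2(0 := tl (?s2 0), 0 := code (tree_of (A x)) @ R))"
        by (rule run_Pop, simp, rule computesD[OF a(1)]) (simp add: tree_of_prod_def True)
      then have "exec (Cond 0 1 (Pop 0 ;; a) (Push 0 2 ;; d)) ?s2 (1 + ba x + 2)
          (?s2(0 := tl (?s2 0), 0 := code (tree_of (A x)) @ R))"
        by - (rule exec_Cond_True[rotated 2], assumption, auto simp: tree_of_prod_def True)
      then show ?thesis by (rule exec_eq) (auto simp: \<open>h x = A x\<close>)
    next
      case False
      then obtain v where v: "tree_of (g x) = tree_of v" "h x = B (v, x)" using h[of x] by auto
      obtain t u where tu: "tree_of v = Node t u" using False v by (cases "tree_of v") auto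
      have "exec (Push 0 2 ;; d) ?s2 (2 + bd (v, x)) (?s2(0 := 2 # ?s2 0, 0 := code (tree_of (B (v, x))) @ R))"
        by (rule run_Push, simp, simp, rule computesD[OF d(1)]) (simp add: tree_of_prod_def v)
      then have "exec (Cond 0 1 (Pop 0 ;; a) (Push 0 2 ;; d)) ?s2 (2 + bd (v, x) + 2)
          (?s2(0 := 2 # ?s2 0, 0 := code (tree_of (B (v, x))) @ R))"
        by - (rule exec_Cond_False[rotated 2], assumption, auto simp: tree_of_prod_def v tu)
      then show ?thesis
        by (rule exec_eq) (use p[of "(v, x)"] v in \<open>auto simp: dsize_def tree_of_prod_def\<close>)
    qed
    from exec_Seq[OF 1 exec_Seq[OF exec_Pop this]]
    show "exec (c ;; Pop 0 ;; Cond 0 1 (Pop 0 ;; a) (Push 0 2 ;; d)) s (?b x) (s(0 := code (tree_of (h x)) @ R))"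
      by (rule exec_eq) auto
  qed
  moreover have "pbounded ?b"
    by (intro pbounded_intros c a)
  moreover have "pbounded (\<lambda>s. dsize (h s))"
  proof (rule pbounded_mono)
    show "pbounded (\<lambda>s. dsize (A s) + poly q (dsize (g s, s)))" by (intro pbounded_intros c a)
    fix s
    from h[of s] show "dsize (h s) \<le> dsize (A s) + poly q (dsize (g s, s))"
    proof
      assume "\<exists>v. tree_of (g s) = tree_of v \<and> tree_of v \<noteq> Leaf \<and> h s = B (v, s)"
      then obtain v where "tree_of (g s) = tree_of v" "h s = B (v, s)" by blast
      then show ?thesis using q[of "(v, s)"] by (simp add: dsize_def tree_of_prod_def)
    qed simp
  qed
  ultimately show ?thesis by (rule ptimeI)
qed


text \<open>With the root of the pair of list and state removed, the top symbol tells whether the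
  list is empty. If not, pushing a 2 turns the cell and the state into \<open>((x, xs), st)\<close>,
  exactly the argument format of the body; no data are moved.\<close>

definition fold_loop :: "com \<Rightarrow> com" where
  "fold_loop c = Pop 0 ;; While 0 1 (Push 0 2 ;; c ;; Pop 0) ;; Push 0 2"

lemma computes_fold_loop:
  fixes g :: "'a::data \<Rightarrow> 'st::data \<Rightarrow> 'st"
  assumes "computes c (\<lambda>z. (snd (fst z), g (fst (fst z)) (snd z))) b"
  shows "computes (fold_loop c) (\<lambda>z. ([] :: 'a list, fold g (fst z) (snd z)))
    (\<lambda>z. (\<Sum>i<length (fst z). b ((fst z ! i, drop (Suc i) (fst z)), fold g (take i (fst z)) (snd z)) + 5) + 4)"
proof (rule computesI)
  fix s :: "nat \<Rightarrow> nat list" and z :: "'a list \<times> 'st" and R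
  assume *: "s 0 = code (tree_of z) @ R"
  obtain xs st where z: "z = (xs, st)" by (cases z)
  let ?W = "While 0 1 (Push 0 2 ;; c ;; Pop 0)"
  have loop: "exec ?W s ((\<Sum>i<length xs. b ((xs ! i, drop (Suc i) xs), fold g (take i xs) st) + 5) + 1)
      (s(0 := 1 # code (tree_of (fold g xs st)) @ R))"
    if "s 0 = code (tree_of xs) @ code (tree_of st) @ R" for s
    using that
  proof (induction xs arbitrary: s st)
    case Nil
    then show ?case by (intro exec_eq[OF exec_While_end]) (auto simp: fun_eq_iff)
  next
    case (Cons x xs)
    let ?s1 = "s(0 := 2 # s 0)"
    let ?s2 = "?s1(0 := code (tree_of (xs, g x st)) @ R)"
    let ?s3 = "?s2(0 := tl (?s2 0))"
    have 1: "exec c ?s1 (b ((x, xs), st)) ?s2"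
      using computesD[OF assms, of ?s1 "((x, xs), st)" R] Cons.prems by (simp add: tree_of_prod_def)
    have "exec (Push 0 2 ;; c ;; Pop 0) s (2 + (b ((x, xs), st) + 1)) ?s3"
      by (rule run_Push[OF _ _ exec_Seq[OF 1 exec_Pop]]) auto
    moreover have "exec ?W ?s3 ((\<Sum>i<length xs. b ((xs ! i, drop (Suc i) xs), fold g (take i xs) (g x st)) + 5) + 1)
      (?s3(0 := 1 # code (tree_of (fold g xs (g x st))) @ R))"
      by (rule Cons.IH) (simp add: tree_of_prod_def)
    ultimately have "exec ?W s ((2 + (b ((x, xs), st) + 1)) +
        ((\<Sum>i<length xs. b ((xs ! i, drop (Suc i) xs), fold g (take i xs) (g x st)) + 5) + 1) + 2)
        (?s3(0 := 1 # code (tree_of (fold g xs (g x st))) @ R))"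
      using Cons.prems by (intro exec_While_step[rotated 2]) auto
    then show ?case
      by (rule exec_eq) (auto simp: fun_eq_iff sum.lessThan_Suc_shift simp del: sum.lessThan_Suc)
  qed
  let ?s1 = "s(0 := tl (s 0))"
  have "exec (fold_loop c) s (1 + (((\<Sum>i<length xs. b ((xs ! i, drop (Suc i) xs), fold g (take i xs) st) + 5) + 1) + 2))
    (s(0 := 2 # 1 # code (tree_of (fold g xs st)) @ R))"
    unfolding fold_loop_def
    by (rule exec_eq, rule run_Pop[OF _ exec_Seq[OF loop exec_Push]])
       (use * in \<open>auto simp: z tree_of_prod_def fun_eq_iff\<close>)
  then show "exec (fold_loop c) s ((\<Sum>i<length (fst z). b ((fst z ! i, drop (Suc i) (fst z)), fold g (take i (fst z)) (snd z)) + 5) + 4)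
     (s(0 := code (tree_of ([] :: 'a list, fold g (fst z) (snd z))) @ R))"
    by (rule exec_eq) (auto simp: z tree_of_prod_def)
qed

lemma dsize_drop: "dsize (drop n xs) \<le> dsize xs"
  using dsize_append[of "take n xs" "drop n xs"] dsize_pos[of "take n xs"] unfolding append_take_drop_id by linarith

text \<open>Recursion on lists stays in polynomial time only if all intermediate results are of
  polynomial size, which has to be bounded by hand.\<close>

lemma ptime_fold:
  fixes G :: "'s::data \<Rightarrow> 'a::data \<Rightarrow> 'c::data \<Rightarrow> 'c"
  assumes G: "ptime (\<lambda>z. G (fst z) (fst (snd z)) (snd (snd z)))" and L: "ptime L" and I: "ptime I"
    and B: "pbounded B" "\<And>s ys zs. L s = ys @ zs \<Longrightarrow> dsize (fold (G s) ys (I s)) \<le> B s"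
  shows "ptime (\<lambda>s. fold (G s) (L s) (I s))"
proof -
  \<comment> \<open>The loop body sees only the list and the state, so the parameter
    \<open>s\<close> travels inside the state.\<close>
  define g where "g x z = (fst z, G (fst z) x (snd z))" for x and z :: "'s \<times> 'c"
  have fold_g: "fold g xs (s, a) = (s, fold (G s) xs a)" for xs s a
    by (induction xs arbitrary: a) (auto simp: g_def)
  have "ptime (\<lambda>z :: ('a \<times> 'a list) \<times> ('s \<times> 'c). (snd (fst z), g (fst (fst z)) (snd z)))"
    unfolding g_def
    by (intro ptime_Pair ptime_comp[OF ptime_comp[OF ptime_fst0] ptime_snd0, OF ptime_id]
        ptime_comp[OF _ G, of "\<lambda>z. (fst (snd z), fst (fst z), snd (snd z))", simplified]
        ptime_comp[OF _ ptime_fst0] ptime_comp[OF _ ptime_snd0] ptime_id ptime_fst0 ptime_snd0)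
  then obtain c b where c:
    "computes c (\<lambda>z :: ('a \<times> 'a list) \<times> ('s \<times> 'c). (snd (fst z), g (fst (fst z)) (snd z))) b" "pbounded b"
    unfolding ptime_def by blast
  have init: "ptime (\<lambda>s. (L s, s, I s))" by (intro ptime_Pair L I ptime_id)
  then obtain d bd where d: "computes d (\<lambda>s. (L s, s, I s)) bd" "pbounded bd"
    unfolding ptime_def by blast
  let ?bl = "\<lambda>z. (\<Sum>i<length (fst z). b ((fst z ! i, drop (Suc i) (fst z)), fold g (take i (fst z)) (snd z)) + 5) + 4"
  have comp: "computes (d ;; fold_loop c) (\<lambda>s. ([] :: 'a list, s, fold (G s) (L s) (I s)))
    (\<lambda>s. bd s + ?bl (L s, s, I s))"
    using computes_comp[OF d(1) computes_fold_loop[OF c(1)]] by (simp add: fold_g)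
  obtain q where q: "\<And>z. b z \<le> poly q (dsize z)" using c(2) unfolding pbounded_def by blast
  \<comment> \<open>Bounds the argument of the body in every round: the current element, the
    remaining list, the parameter, the accumulated value, and 3 for the pairs joining them.\<close>
  let ?H = "\<lambda>s. dsize (L s) + dsize (L s) + dsize s + B s + 3"
  have pL: "pbounded (\<lambda>s. dsize (L s))" by (rule ptime_pbounded[OF L])
  have "pbounded (\<lambda>s. dsize (L s) * (poly q (?H s) + 5) + 4)"
    by (intro pbounded_intros pL B)
  then have "pbounded (\<lambda>s. ?bl (L s, s, I s))"
  proof (rule pbounded_mono)
    fix s
    have "b ((L s ! i, drop (Suc i) (L s)), fold g (take i (L s)) (s, I s)) + 5 \<le> poly q (?H s) + 5"
      if "i < length (L s)" for i
    proof -
      have "dsize (fold (G s) (take i (L s)) (I s)) \<le> B s"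
        by (rule B(2)[of _ _ "drop i (L s)"]) simp
      moreover have "dsize (L s ! i) \<le> dsize (L s)" using that by (intro dsize_elem_le) auto
      ultimately have "dsize ((L s ! i, drop (Suc i) (L s)), fold g (take i (L s)) (s, I s)) \<le> ?H s"
        using dsize_drop[of "Suc i" "L s"] by (simp add: fold_g)
      then show ?thesis using q poly_nat_mono le_trans add_right_mono by meson
    qed
    then have "(\<Sum>i<length (L s). b ((L s ! i, drop (Suc i) (L s)), fold g (take i (L s)) (s, I s)) + 5)
        \<le> length (L s) * (poly q (?H s) + 5)"
      using sum_bounded_above[of "{..<length (L s)}"] by (metis (no_types, lifting) card_lessThan lessThan_iff of_nat_id)
    also have "\<dots> \<le> dsize (L s) * (poly q (?H s) + 5)"
      by (intro mult_right_mono length_le_dsize) simp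
    finally show "?bl (L s, s, I s) \<le> dsize (L s) * (poly q (?H s) + 5) + 4" by simp
  qed
  moreover have "pbounded (\<lambda>s. dsize ([] :: 'a list, s, fold (G s) (L s) (I s)))"
    by (rule pbounded_mono[of "\<lambda>s. dsize s + B s + 3"])
       (use B(2)[of _ _ "[]"] in \<open>auto intro!: pbounded_intros B(1)\<close>)
  ultimately have "ptime (\<lambda>s. ([] :: 'a list, s, fold (G s) (L s) (I s)))"
    using pbounded_add[OF d(2)] by (intro ptimeI[OF comp])
  from ptime_comp[OF ptime_comp[OF this ptime_snd0] ptime_snd0] show ?thesis by simp
qed

section \<open>Closure under constructors, case distinctions and list functions\<close>

lemma ptime_fst: "ptime g \<Longrightarrow> ptime (\<lambda>s. fst (g s))"
  by (rule ptime_comp[OF _ ptime_fst0])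

lemma ptime_snd: "ptime g \<Longrightarrow> ptime (\<lambda>s. snd (g s))"
  by (rule ptime_comp[OF _ ptime_snd0])

lemma ptime_Cons:
  assumes "ptime g" "ptime h" shows "ptime (\<lambda>s. g s # h s)"
proof -
  have "ptime (\<lambda>p. fst p # snd p)" by (rule ptime_recode) (simp add: tree_of_prod_def)
  from ptime_comp[OF ptime_Pair[OF assms] this] show ?thesis by simp
qed

lemma ptime_Some:
  assumes "ptime g" shows "ptime (\<lambda>s. Some (g s))"
proof -
  have "ptime (\<lambda>p :: 'b \<times> unit. Some (fst p))"
    by (rule ptime_recode) (simp add: tree_of_prod_def tree_of_option_def tree_of_unit_def)
  from ptime_comp[OF ptime_Pair[OF assms ptime_const[of "()"]] this] show ?thesis by simp
qed

text \<open>\<open>True\<close> has the tree of a pair of units, which supplies the type of the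
  value in the non-leaf case.\<close>

lemma ptime_if:
  assumes "ptime P" "ptime A" "ptime B" shows "ptime (\<lambda>s. if P s then A s else B s)"
  by (rule ptime_branch[OF assms(1,3) ptime_comp[OF ptime_snd0 assms(2)],
        where 'v = "unit \<times> unit"])
     (auto simp: tree_of_bool_def tree_of_prod_def tree_of_unit_def)

lemma ptime_case_list:
  assumes "ptime L" "ptime A" "ptime (\<lambda>z. B (snd z) (fst (fst z)) (snd (fst z)))"
  shows "ptime (\<lambda>s. case L s of [] \<Rightarrow> A s | x # xs \<Rightarrow> B s x xs)"
  by (rule ptime_branch[OF assms])
     (auto simp: tree_of_prod_def split: list.split)

lemma ptime_case_option:
  assumes "ptime L" "ptime A" "ptime (\<lambda>z. B (snd z) (fst z))"
  shows "ptime (\<lambda>s. case L s of None \<Rightarrow> A s | Some x \<Rightarrow> B s x)"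
proof (rule ptime_branch[OF assms(1,2)])
  show "ptime (\<lambda>z :: ('b \<times> unit) \<times> 'a. B (snd z) (fst (fst z)))"
    using ptime_comp[OF ptime_Pair[OF ptime_comp[OF ptime_fst0 ptime_fst0] ptime_snd0] assms(3)]
    by simp
qed (auto simp: tree_of_prod_def tree_of_option_def tree_of_unit_def split: option.split)

lemmas ptime_base = ptime_id ptime_const ptime_fst ptime_snd ptime_Pair ptime_Cons ptime_Some
  ptime_if ptime_case_list ptime_case_option

lemma ptime_conj:
  assumes "ptime P" "ptime Q" shows "ptime (\<lambda>s. P s \<and> Q s)"
  by (rule ptime_cong[OF ptime_if[OF assms ptime_const[of False]]]) simp

lemma ptime_disj:
  assumes "ptime P" "ptime Q" shows "ptime (\<lambda>s. P s \<or> Q s)"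
  by (rule ptime_cong[OF ptime_if[OF assms(1) ptime_const[of True] assms(2)]]) simp

lemma ptime_not:
  assumes "ptime P" shows "ptime (\<lambda>s. \<not> P s)"
  by (rule ptime_cong[OF ptime_if[OF assms(1) ptime_const[of False] ptime_const[of True]]]) simp

lemma ptime_tl: "ptime g \<Longrightarrow> ptime (\<lambda>s. tl (g s))"
  by (rule ptime_cong[OF ptime_case_list[where L = g and A = "\<lambda>_. []" and B = "\<lambda>_ x xs. xs"]])
     (auto intro!: ptime_base split: list.split)

lemma ptime_is_Nil: "ptime g \<Longrightarrow> ptime (\<lambda>s. g s = [])"
  by (rule ptime_cong[OF ptime_case_list[where L = g and A = "\<lambda>_. True" and B = "\<lambda>_ x xs. False"]])
     (auto intro!: ptime_base split: list.split)

lemma dsize_rev [simp]: "dsize (rev xs) = dsize xs"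
proof (induction xs)
  case (Cons x xs)
  then show ?case using dsize_append[of "rev xs" "[x]"] by simp
qed simp

lemma ptime_rev:
  assumes "ptime L" shows "ptime (\<lambda>s. rev (L s))"
proof -
  have "ptime (\<lambda>xs :: 'b list. fold (\<lambda>x a. x # a) xs [])"
  proof (rule ptime_fold[where B = dsize])
    fix s ys zs :: "'b list" assume "s = ys @ zs"
    moreover have "fold (\<lambda>x a. x # a) ys [] = rev ys" by (simp add: fold_Cons_rev)
    ultimately show "dsize (fold (\<lambda>x a. x # a) ys []) \<le> dsize s"
      using dsize_append[of ys zs] dsize_pos[of zs] by (simp del: dsize_pos dsize_pos')
  qed (intro ptime_base pbounded_intros)+
  from ptime_comp[OF assms this] show ?thesis by (simp add: fold_Cons_rev)
qed

lemma ptime_comp2: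
  assumes "ptime (\<lambda>z. h (fst z) (snd z))" "ptime f" "ptime g"
  shows "ptime (\<lambda>s. h (f s) (g s))"
  using ptime_comp[OF ptime_Pair[OF assms(2,3)] assms(1)] by simp

lemma ptime_comp4:
  assumes "ptime (\<lambda>z. h (fst z) (fst (snd z)) (fst (snd (snd z))) (snd (snd (snd z))))"
    "ptime f" "ptime g" "ptime k" "ptime l"
  shows "ptime (\<lambda>s. h (f s) (g s) (k s) (l s))"
  using ptime_comp[OF ptime_Pair[OF assms(2) ptime_Pair[OF assms(3) ptime_Pair[OF assms(4,5)]]] assms(1)]
  by simp

text \<open>Primitive recursion works from the end of the list, hence the fold over
  \<open>rev\<close>. The accumulator pairs the suffix already processed with its value, because
  \<open>F\<close> may use both. Its intermediate values are values of \<open>f\<close> on suffixes,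
  so a size bound on \<open>f\<close> itself suffices.\<close>

lemma ptime_primrec:
  fixes f :: "'e::data \<Rightarrow> 'a::data list \<Rightarrow> 'b::data"
  assumes f: "\<And>e. f e [] = A e" "\<And>e x xs. f e (x # xs) = F e x xs (f e xs)"
    and A: "ptime A"
    and F: "ptime (\<lambda>z. F (fst z) (fst (snd z)) (fst (snd (snd z))) (snd (snd (snd z))))"
    and B: "pbounded B" "\<And>e xs. dsize (f e xs) \<le> B (e, xs)"
    and E: "ptime E" and L: "ptime L"
  shows "ptime (\<lambda>s. f (E s) (L s))"
proof -
  let ?G = "\<lambda>s x a. (x # fst a, F (fst s) x (fst a) (snd a))"
  have fold: "fold (\<lambda>x a. (x # fst a, F e x (fst a) (snd a))) (rev xs) ([], A e) = (xs, f e xs)" for e xs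
    by (induction xs) (auto simp: f)
  obtain q where q: "\<And>z. B z \<le> poly q (dsize z)" using B(1) unfolding pbounded_def by blast
  have "ptime (\<lambda>s :: 'e \<times> 'a list. fold (?G s) (rev (snd s)) ([], A (fst s)))"
  proof (rule ptime_fold[where B = "\<lambda>s. dsize s + poly q (dsize s) + 1"])
    show "ptime (\<lambda>z :: ('e \<times> 'a list) \<times> ('a \<times> 'a list \<times> 'b).
        (fst (snd z) # fst (snd (snd z)), F (fst (fst z)) (fst (snd z)) (fst (snd (snd z))) (snd (snd (snd z)))))"
      by (intro ptime_comp4[OF F] ptime_base)
    show "ptime (\<lambda>s :: 'e \<times> 'a list. ([] :: 'a list, A (fst s)))"
      by (intro ptime_base ptime_comp[OF ptime_fst0 A])
    fix s :: "'e \<times> 'a list" and ys zs assume s: "rev (snd s) = ys @ zs"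
    obtain e xs where es: "s = (e, xs)" by (cases s)
    have xs: "xs = rev zs @ rev ys" using s es by (metis rev_append rev_rev_ident snd_conv)
    have le: "dsize (rev ys) \<le> dsize xs"
      using dsize_append[of "rev zs" "rev ys"] dsize_pos[of "rev zs"] xs by (simp del: dsize_pos dsize_pos')
    have "dsize (f e (rev ys)) \<le> poly q (dsize (e, rev ys))" using B(2) q le_trans by blast
    also have "\<dots> \<le> poly q (dsize s)" using le es by (intro poly_nat_mono) simp
    finally show "dsize (fold (?G s) ys ([], A (fst s))) \<le> dsize s + poly q (dsize s) + 1"
      using fold[of e "rev ys"] le es by simp
  qed (intro ptime_base ptime_rev pbounded_intros)+
  from ptime_comp[OF ptime_comp[OF ptime_Pair[OF E L] this] ptime_snd0] show ?thesis
    by (simp add: fold)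
qed

lemma ptime_map:
  fixes h :: "'e::data \<Rightarrow> 'a::data \<Rightarrow> 'b::data"
  assumes h: "ptime (\<lambda>z. h (fst z) (snd z))" and L: "ptime L"
  shows "ptime (\<lambda>s. map (h s) (L s))"
proof -
  obtain q where q: "\<And>z. dsize (h (fst z) (snd z)) \<le> poly q (dsize z)"
    using ptime_pbounded[OF h] unfolding pbounded_def by blast
  show ?thesis
  proof (rule ptime_primrec[where f = "\<lambda>e xs. map (h e) xs" and A = "\<lambda>_. []"
        and F = "\<lambda>e x xs r. h e x # r" and B = "\<lambda>z. 1 + dsize z * (poly q (dsize z) + 1)"])
    show "ptime (\<lambda>z :: 'e \<times> 'a \<times> 'a list \<times> 'b list. h (fst z) (fst (snd z)) # snd (snd (snd z)))"
      by (intro ptime_comp2[OF h] ptime_base)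
    fix e :: 'e and xs :: "'a list"
    show "dsize (map (h e) xs) \<le> 1 + dsize (e, xs) * (poly q (dsize (e, xs)) + 1)"
    proof (rule dsize_list_le)
      fix y assume "y \<in> set (map (h e) xs)"
      then obtain x where x: "x \<in> set xs" "y = h e x" by auto
      have "dsize (h e x) \<le> poly q (dsize (e, x))" using q[of "(e, x)"] by simp
      also have "\<dots> \<le> poly q (dsize (e, xs))"
        using dsize_elem_le[OF x(1)] by (intro poly_nat_mono) simp
      finally show "dsize y \<le> poly q (dsize (e, xs))" using x by simp
    next
      show "length (map (h e) xs) \<le> dsize (e, xs)" using length_le_dsize[of xs] by simp
    qed
  qed (intro ptime_base pbounded_intros L | simp)+
qed

lemma ptime_append: "ptime g \<Longrightarrow> ptime h \<Longrightarrow> ptime (\<lambda>s. g s @ h s)"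
  by (rule ptime_primrec[where f = "\<lambda>ys xs. xs @ ys" and A = "\<lambda>ys. ys" and F = "\<lambda>e x xs r. x # r"
        and B = dsize])
     (auto intro!: ptime_base pbounded_intros simp: add.commute[of "dsize (_ @ _)"]
       dsize_append[unfolded Suc_eq_plus1[symmetric], THEN eq_refl, THEN Suc_leD, THEN order_trans])

lemma ptime_concat:
  assumes "ptime g" shows "ptime (\<lambda>s. concat (g s))"
proof (rule ptime_primrec[where f = "\<lambda>_ :: unit. concat" and A = "\<lambda>_. []" and E = "\<lambda>_. ()"
      and F = "\<lambda>e x xs r. x @ r" and B = dsize])
  fix e :: unit and xs :: "'b list list"
  have "dsize (concat xs) \<le> dsize xs"
  proof (induction xs)
    case (Cons x xs)
    then show ?case using dsize_append[of x "concat xs"] by simp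
  qed simp
  then show "dsize (concat xs) \<le> dsize (e, xs)" by simp
qed (auto intro!: ptime_base ptime_append pbounded_intros assms)

lemma ptime_list_all:
  fixes h :: "'e::data \<Rightarrow> 'a::data \<Rightarrow> bool"
  assumes h: "ptime (\<lambda>z. h (fst z) (snd z))" and L: "ptime L"
  shows "ptime (\<lambda>s. list_all (h s) (L s))"
proof (rule ptime_primrec[where f = "\<lambda>e xs. list_all (h e) xs" and A = "\<lambda>_. True"
      and F = "\<lambda>e x xs r. h e x \<and> r" and B = "\<lambda>_. 3"])
  show "ptime (\<lambda>z :: 'e \<times> 'a \<times> 'a list \<times> bool. h (fst z) (fst (snd z)) \<and> snd (snd (snd z)))"
    by (intro ptime_conj ptime_comp2[OF h] ptime_base)
qed (auto intro!: ptime_base pbounded_intros L dsize_bool_le)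

text \<open>One list serves as a unary counter for the other; lengths can be compared without ever
  forming a number.\<close>

lemma ptime_drop_length:
  assumes "ptime g" "ptime h" shows "ptime (\<lambda>s. drop (length (g s)) (h s))"
proof -
  have fold: "fold (\<lambda>_. tl) xs ys = drop (length xs) ys" for xs :: "'b list" and ys :: "'c list"
    by (induction xs arbitrary: ys) (auto simp: drop_Suc)
  have "ptime (\<lambda>s. fold (\<lambda>_. tl) (g s) (h s))"
    by (rule ptime_fold[where G = "\<lambda>_ _. tl" and B = "\<lambda>s. dsize (h s)"])
       (intro ptime_base ptime_tl assms ptime_pbounded[OF assms(2)] | simp add: fold dsize_drop)+
  then show ?thesis by (simp add: fold)
qed

lemma ptime_length_eq:
  assumes "ptime g" "ptime h" shows "ptime (\<lambda>s. length (g s) = length (h s))"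
  by (rule ptime_cong[OF ptime_conj[OF ptime_is_Nil[OF ptime_drop_length[OF assms]]
        ptime_is_Nil[OF ptime_drop_length[OF assms(2,1)]]]])
     auto

lemma dsize_zip_le: "dsize (zip xs ys) \<le> dsize xs + dsize ys"
proof (induction xs arbitrary: ys)
  case (Cons x xs)
  show ?case
  proof (cases ys)
    case ys: (Cons y ys')
    show ?thesis using Cons[of ys'] by (simp add: ys)
  qed simp
qed simp

text \<open>Both lists shrink together, so this is a fold over the first with the unread part of the
  second in the accumulator.\<close>

lemma ptime_zip:
  fixes g :: "'s::data \<Rightarrow> 'a::data list" and h :: "'s \<Rightarrow> 'b::data list"
  assumes "ptime g" "ptime h" shows "ptime (\<lambda>s. zip (g s) (h s))"
proof -
  define G where "G x a = (case fst a of [] \<Rightarrow> ([], snd a) | y # ys \<Rightarrow> (ys, (x, y) # snd a))"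
    for x :: 'a and a :: "'b list \<times> ('a \<times> 'b) list"
  have fold: "fold G xs (ys, out) = (drop (length xs) ys, rev (zip xs ys) @ out)" for xs ys out
    by (induction xs arbitrary: ys out) (auto simp: G_def split: list.split)
  have "ptime (\<lambda>s. fold G (g s) (h s, []))"
  proof (rule ptime_fold[where G = "\<lambda>_. G" and B = "\<lambda>s. 2 * dsize (h s) + dsize (g s) + 1"])
    fix s ys zs assume s: "g s = ys @ zs"
    have "dsize (zip ys (h s)) \<le> dsize ys + dsize (h s)" "dsize ys \<le> dsize (g s)"
      using dsize_append[of ys zs] dsize_pos[of zs] dsize_zip_le s by (auto simp del: dsize_pos dsize_pos')
    then show "dsize (fold G ys (h s, [])) \<le> 2 * dsize (h s) + dsize (g s) + 1"
      using dsize_drop[of "length ys" "h s"] by (simp add: fold)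
  next
    show "ptime (\<lambda>z :: 's \<times> 'a \<times> 'b list \<times> ('a \<times> 'b) list. G (fst (snd z)) (snd (snd z)))"
      unfolding G_def by (intro ptime_base)
    show "pbounded (\<lambda>s. 2 * dsize (h s) + dsize (g s) + 1)"
      by (intro pbounded_intros assms[THEN ptime_pbounded])
  qed (intro ptime_base assms)+
  from ptime_rev[OF ptime_snd[OF this]] show ?thesis by (simp add: fold)
qed

lemmas ptime_intros = ptime_base ptime_conj ptime_disj ptime_not ptime_tl ptime_is_Nil ptime_rev
  ptime_append ptime_concat ptime_drop_length ptime_length_eq ptime_zip ptime_map ptime_list_all


section \<open>Binary numbers\<close>

primrec bval :: "bool list \<Rightarrow> nat" where
  "bval [] = 0"
| "bval (b # bs) = of_bool b + 2 * bval bs"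

text \<open>\<open>zip\<close> would truncate the longer operand, so the shorter one is padded with
  leading zeros.\<close>

definition bzip :: "bool list \<Rightarrow> bool list \<Rightarrow> (bool \<times> bool) list" where
  "bzip xs ys = zip (xs @ map (\<lambda>_. False) (drop (length xs) ys)) (ys @ map (\<lambda>_. False) (drop (length ys) xs))"

lemma bval_append_zeros: "bval (xs @ map (\<lambda>_. False) zs) = bval xs"
proof -
  have "bval (map (\<lambda>_. False) zs) = 0" by (induction zs) auto
  then show ?thesis by (induction xs) auto
qed

lemma length_bzip: "length (bzip xs ys) = max (length xs) (length ys)"
  by (simp add: bzip_def)

lemma bval_bzip: "bval (map fst (bzip xs ys)) = bval xs" "bval (map snd (bzip xs ys)) = bval ys"
  by (simp_all add: bzip_def bval_append_zeros)

lemma ptime_bzip: "ptime f \<Longrightarrow> ptime g \<Longrightarrow> ptime (\<lambda>s. bzip (f s) (g s))"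
  unfolding bzip_def by (intro ptime_intros)

lemma dsize_bools_le: "length xs \<le> n \<Longrightarrow> dsize (xs :: bool list) \<le> 4 * n + 1"
  using dsize_bools[of xs] by linarith

text \<open>The sum without and with a carry into the lowest digit. Computing both makes this a
  recursion without a varying parameter.\<close>

primrec carry_add :: "(bool \<times> bool) list \<Rightarrow> bool list \<times> bool list" where
  "carry_add [] = ([], [True])"
| "carry_add (p # ps) =
    ((if fst p then \<not> snd p else snd p) # (if fst p \<and> snd p then snd (carry_add ps) else fst (carry_add ps)),
     (if fst p then snd p else \<not> snd p) # (if fst p \<or> snd p then snd (carry_add ps) else fst (carry_add ps)))"

lemma bval_carry_add:
  "bval (fst (carry_add ps)) = bval (map fst ps) + bval (map snd ps)"
  "bval (snd (carry_add ps)) = bval (map fst ps) + bval (map snd ps) + 1"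
  by (induction ps) auto

lemma length_carry_add:
  "length (fst (carry_add ps)) \<le> length ps + 1" "length (snd (carry_add ps)) \<le> length ps + 1"
  by (induction ps) auto

lemma ptime_carry_add: "ptime L \<Longrightarrow> ptime (\<lambda>s. carry_add (L s))"
proof (rule ptime_primrec[where f = "\<lambda>_ :: unit. carry_add" and E = "\<lambda>_. ()" and A = "\<lambda>_. ([], [True])"
      and F = "\<lambda>_ p _ r. ((if fst p then \<not> snd p else snd p) # (if fst p \<and> snd p then snd r else fst r),
         (if fst p then snd p else \<not> snd p) # (if fst p \<or> snd p then snd r else fst r))"
      and B = "\<lambda>z. 8 * dsize z + 11"])
  fix e :: unit and xs
  show "dsize (carry_add xs) \<le> 8 * dsize (e, xs) + 11"
    using length_carry_add[of xs] length_le_dsize[of xs]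
      dsize_bools_le[of "fst (carry_add xs)" "dsize xs + 1"] dsize_bools_le[of "snd (carry_add xs)" "dsize xs + 1"]
    by (cases "carry_add xs") auto
qed (auto intro!: ptime_intros pbounded_intros)

definition badd :: "bool list \<Rightarrow> bool list \<Rightarrow> bool list" where
  "badd xs ys = fst (carry_add (bzip xs ys))"

lemma bval_badd [simp]: "bval (badd xs ys) = bval xs + bval ys"
  by (simp add: badd_def bval_carry_add bval_bzip)

lemma length_badd: "length (badd xs ys) \<le> max (length xs) (length ys) + 1"
  using length_carry_add(1)[of "bzip xs ys"] by (simp add: badd_def length_bzip)

lemma ptime_badd: "ptime f \<Longrightarrow> ptime g \<Longrightarrow> ptime (\<lambda>s. badd (f s) (g s))"
  unfolding badd_def by (intro ptime_intros ptime_bzip ptime_carry_add)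

text \<open>The two components are the weak and the strict comparison. Higher digits take
  precedence, and the lowest digit only decides which comparison of the rest is relevant; as with
  the carry, computing both avoids a varying parameter.\<close>

primrec compare_bits :: "(bool \<times> bool) list \<Rightarrow> bool \<times> bool" where
  "compare_bits [] = (True, False)"
| "compare_bits (p # ps) =
    (if fst p \<and> \<not> snd p then snd (compare_bits ps) else fst (compare_bits ps),
     if \<not> fst p \<and> snd p then fst (compare_bits ps) else snd (compare_bits ps))"

lemma compare_bits:
  "fst (compare_bits ps) \<longleftrightarrow> bval (map fst ps) \<le> bval (map snd ps)"
  "snd (compare_bits ps) \<longleftrightarrow> bval (map fst ps) < bval (map snd ps)"
proof (induction ps)
  case (Cons p ps)
  { case 1 show ?case using Cons by (cases p; cases "fst p"; cases "snd p") auto }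
  { case 2 show ?case using Cons by (cases p; cases "fst p"; cases "snd p") auto }
qed auto

lemma ptime_compare_bits: "ptime L \<Longrightarrow> ptime (\<lambda>s. compare_bits (L s))"
proof (rule ptime_primrec[where f = "\<lambda>_ :: unit. compare_bits" and E = "\<lambda>_. ()" and A = "\<lambda>_. (True, False)"
      and F = "\<lambda>_ p _ r. (if fst p \<and> \<not> snd p then snd r else fst r, if \<not> fst p \<and> snd p then fst r else snd r)"
      and B = "\<lambda>z. 7"])
  fix e :: unit and xs
  show "dsize (compare_bits xs) \<le> 7"
    using dsize_bool_le[of "fst (compare_bits xs)"] dsize_bool_le[of "snd (compare_bits xs)"]
    by (cases "compare_bits xs") auto
qed (auto intro!: ptime_intros pbounded_intros)

definition ble :: "bool list \<Rightarrow> bool list \<Rightarrow> bool" where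
  "ble xs ys = fst (compare_bits (bzip xs ys))"

definition blt :: "bool list \<Rightarrow> bool list \<Rightarrow> bool" where
  "blt xs ys = snd (compare_bits (bzip xs ys))"

lemma ble_iff [simp]: "ble xs ys \<longleftrightarrow> bval xs \<le> bval ys"
  and blt_iff [simp]: "blt xs ys \<longleftrightarrow> bval xs < bval ys"
  by (simp_all add: ble_def blt_def compare_bits bval_bzip)

lemma ptime_ble: "ptime f \<Longrightarrow> ptime g \<Longrightarrow> ptime (\<lambda>s. bval (f s) \<le> bval (g s))"
  unfolding ble_iff[symmetric] ble_def by (intro ptime_intros ptime_bzip ptime_compare_bits)

lemma ptime_blt: "ptime f \<Longrightarrow> ptime g \<Longrightarrow> ptime (\<lambda>s. bval (f s) < bval (g s))"
  unfolding blt_iff[symmetric] blt_def by (intro ptime_intros ptime_bzip ptime_compare_bits)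

lemma ptime_beq: "ptime f \<Longrightarrow> ptime g \<Longrightarrow> ptime (\<lambda>s. bval (f s) = bval (g s))"
  by (rule ptime_cong[OF ptime_conj[OF ptime_ble[of f g] ptime_ble[of g f]]]) auto

primrec bmul :: "bool list \<Rightarrow> bool list \<Rightarrow> bool list" where
  "bmul ys [] = []"
| "bmul ys (b # bs) = (if b then badd ys (False # bmul ys bs) else False # bmul ys bs)"

lemma bval_bmul [simp]: "bval (bmul ys xs) = bval xs * bval ys"
  by (induction xs) (auto simp: algebra_simps)

text \<open>Each digit of the second argument contributes one digit for the shift and one for a
  possible carry.\<close>

lemma length_bmul: "length (bmul ys xs) \<le> 2 * length xs + length ys"
proof (induction xs)
  case (Cons b xs)
  then show ?case using length_badd[of ys "False # bmul ys xs"] by (auto simp: max_def split: if_splits)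
qed simp

lemma ptime_bmul: "ptime f \<Longrightarrow> ptime g \<Longrightarrow> ptime (\<lambda>s. bmul (f s) (g s))"
proof (rule ptime_primrec[where f = bmul and A = "\<lambda>_. []"
      and F = "\<lambda>ys b bs r. if b then badd ys (False # r) else False # r"
      and B = "\<lambda>z. 4 * (2 * dsize z) + 1"])
  fix ys xs
  show "dsize (bmul ys xs) \<le> 4 * (2 * dsize (ys, xs)) + 1"
    using length_bmul[of ys xs] length_le_dsize[of xs] length_le_dsize[of ys]
    by (intro dsize_bools_le) simp
qed (auto intro!: ptime_intros ptime_badd pbounded_intros)

primrec bprod :: "bool list list \<Rightarrow> bool list" where
  "bprod [] = [True]"
| "bprod (x # xs) = bmul (bprod xs) x"

lemma bval_bprod: "bval (bprod xs) = prod_list (map bval xs)"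
  by (induction xs) auto

text \<open>The factor 2 in \<open>length_bmul\<close> falls on the new factor, and the accumulated
  product enters with coefficient 1. Lengths thus add up; with the arguments of \<open>bmul\<close>
  exchanged, this estimate would double at every factor.\<close>

lemma length_bprod: "length (bprod xs) \<le> 2 * dsize xs"
proof (induction xs)
  case (Cons x xs)
  then show ?case using length_bmul[of "bprod xs" x] length_le_dsize[of x] by auto
qed simp

lemma ptime_bprod: "ptime L \<Longrightarrow> ptime (\<lambda>s. bprod (L s))"
proof (rule ptime_primrec[where f = "\<lambda>_ :: unit. bprod" and E = "\<lambda>_. ()" and A = "\<lambda>_. [True]"
      and F = "\<lambda>_ x _ r. bmul r x" and B = "\<lambda>z. 4 * (2 * dsize z) + 1"])
  fix e :: unit and xs
  show "dsize (bprod xs) \<le> 4 * (2 * dsize (e, xs)) + 1"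
    using length_bprod[of xs] by (intro dsize_bools_le) simp
qed (auto intro!: ptime_intros ptime_bmul pbounded_intros)


text \<open>Positions in a list are given in binary, lowest digit first; hence an element is found by
  splitting the list into even and odd positions repeatedly.\<close>

primrec unriffle :: "'a list \<Rightarrow> 'a list \<times> 'a list" where
  "unriffle [] = ([], [])"
| "unriffle (x # xs) = (x # snd (unriffle xs), fst (unriffle xs))"

lemma nth_unriffle:
  "length (fst (unriffle xs)) = (length xs + 1) div 2" "length (snd (unriffle xs)) = length xs div 2"
  "2 * i < length xs \<Longrightarrow> fst (unriffle xs) ! i = xs ! (2 * i)"
  "2 * i + 1 < length xs \<Longrightarrow> snd (unriffle xs) ! i = xs ! (2 * i + 1)"
proof (induction xs arbitrary: i)
  case (Cons x xs)
  { case 3 then show ?case using Cons(4)[of "i - 1"] by (cases i) auto }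
  { case 4 then show ?case using Cons(3)[of i] by auto }
qed auto

text \<open>Splitting only distributes the elements, so neither half is larger than the list; this
  bounds all intermediate lists of \<open>lookup\<close>.\<close>

lemma dsize_unriffle: "dsize (fst (unriffle xs)) + dsize (snd (unriffle xs)) = dsize xs + 1"
  by (induction xs) auto

lemma ptime_unriffle: "ptime L \<Longrightarrow> ptime (\<lambda>s. unriffle (L s))"
proof (rule ptime_primrec[where f = "\<lambda>_ :: unit. unriffle" and E = "\<lambda>_. ()" and A = "\<lambda>_. ([], [])"
      and F = "\<lambda>_ x _ r. (x # snd r, fst r)" and B = "\<lambda>z. 2 * dsize z"])
  fix e :: unit and xs :: "'b list"
  show "dsize (unriffle xs) \<le> 2 * dsize (e, xs)"
    using dsize_unriffle[of xs] by (cases "unriffle xs") auto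
qed (auto intro!: ptime_intros pbounded_intros)

text \<open>What remains are the entries whose positions agree with the index in all digits read,
  and the wanted one comes first. Returning this list provides the range test: it is empty iff the
  index is out of range.\<close>

definition lookup :: "'a list \<Rightarrow> bool list \<Rightarrow> 'a list" where
  "lookup xs bs = fold (\<lambda>b xs. if b then snd (unriffle xs) else fst (unriffle xs)) bs xs"

lemma lookup:
  "lookup xs bs \<noteq> [] \<longleftrightarrow> bval bs < length xs"
  "bval bs < length xs \<Longrightarrow> lookup xs bs ! 0 = xs ! bval bs"
proof (induction bs arbitrary: xs)
  case (Cons b bs)
  { case 1
    show ?case using Cons(1)[of "if b then snd (unriffle xs) else fst (unriffle xs)"]
      by (cases b) (auto simp: lookup_def nth_unriffle) }
  { case 2
    then show ?case using Cons(2)[of "if b then snd (unriffle xs) else fst (unriffle xs)"]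
      by (cases b) (auto simp: lookup_def nth_unriffle) }
qed (auto simp: lookup_def)

lemma ptime_lookup:
  assumes "ptime f" "ptime g" shows "ptime (\<lambda>s. lookup (f s) (g s))"
  unfolding lookup_def
proof (rule ptime_fold[where G = "\<lambda>_ b xs. if b then snd (unriffle xs) else fst (unriffle xs)"
      and B = "\<lambda>s. dsize (f s)"])
  fix s ys zs
  have "dsize (fold (\<lambda>b xs. if b then snd (unriffle xs) else fst (unriffle xs)) ys xs) \<le> dsize xs" for xs :: "'b list"
  proof (induction ys arbitrary: xs)
    case (Cons y ys)
    have "dsize (if y then snd (unriffle xs) else fst (unriffle xs)) \<le> dsize xs"
      using dsize_unriffle[of xs] dsize_pos[of "fst (unriffle xs)"] dsize_pos[of "snd (unriffle xs)"]
      by (auto simp del: dsize_pos dsize_pos')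
    then show ?case unfolding fold_simps o_apply by (rule order_trans[OF Cons.IH])
  qed simp
  then show "dsize (fold (\<lambda>b xs. if b then snd (unriffle xs) else fst (unriffle xs)) ys (f s)) \<le> dsize (f s)" .
qed (intro ptime_intros ptime_unriffle assms ptime_pbounded[OF assms(1)])+


section \<open>Decoding\<close>

text \<open>A parser that returns the unread rest can be chained. The size bound is linear in the
  code length because such a bound can be summed over the elements of a list.\<close>

definition decodable :: "('a::data \<Rightarrow> bool list) \<Rightarrow> bool" where
  "decodable e \<longleftrightarrow> (\<exists>p. ptime p \<and> (\<forall>w x r. p w = Some (x, r) \<longleftrightarrow> w = e x @ r)) \<and>
     (\<exists>C. \<forall>x. dsize x \<le> C * length (e x))"

lemma decodable_bit: "decodable (\<lambda>b. [b])"
proof -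
  have "ptime (\<lambda>w :: bool list. case w of [] \<Rightarrow> None | b # r \<Rightarrow> Some (b, r))"
    by (intro ptime_intros)
  moreover have "(case w of [] \<Rightarrow> None | b # r \<Rightarrow> Some (b, r)) = Some (x, r) \<longleftrightarrow> w = [x] @ r"
    for w r and x :: bool
    by (auto split: list.split)
  ultimately show ?thesis
    unfolding decodable_def
    by (intro conjI exI[of _ "\<lambda>w. case w of [] \<Rightarrow> None | b # r \<Rightarrow> Some (b, r)"] exI[of _ 3])
      (auto simp: dsize_bool_le)
qed

lemma decodable_pair:
  fixes e :: "'a::data \<Rightarrow> bool list" and e' :: "'b::data \<Rightarrow> bool list"
  assumes "decodable e" "decodable e'"
  shows "decodable (\<lambda>z. e (fst z) @ e' (snd z))"
proof -
  obtain p C where p: "ptime p" "\<And>w x r. p w = Some (x, r) \<longleftrightarrow> w = e x @ r" "\<And>x. dsize x \<le> C * length (e x)"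
    using assms(1) unfolding decodable_def by blast
  obtain q D where q: "ptime q" "\<And>w x r. q w = Some (x, r) \<longleftrightarrow> w = e' x @ r" "\<And>x. dsize x \<le> D * length (e' x)"
    using assms(2) unfolding decodable_def by blast
  define d where "d w = (case p w of None \<Rightarrow> None | Some u \<Rightarrow>
    (case q (snd u) of None \<Rightarrow> None | Some v \<Rightarrow> Some ((fst u, fst v), snd v)))" for w
  have "ptime d"
    unfolding d_def by (intro ptime_intros p(1) ptime_comp[OF _ q(1)])
  moreover have "d w = Some (z, r) \<longleftrightarrow> w = (e (fst z) @ e' (snd z)) @ r" for w z r
  proof
    assume "d w = Some (z, r)"
    then obtain x u y v where "p w = Some (x, u)" "q u = Some (y, v)" "z = (x, y)" "r = v"
      by (auto simp: d_def split: option.splits)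
    then show "w = (e (fst z) @ e' (snd z)) @ r" by (simp add: p(2) q(2))
  next
    assume "w = (e (fst z) @ e' (snd z)) @ r"
    then have "p w = Some (fst z, e' (snd z) @ r)" "q (e' (snd z) @ r) = Some (snd z, r)"
      by (simp_all add: p(2) q(2))
    then show "d w = Some (z, r)" by (simp add: d_def)
  qed
  moreover have "dsize z \<le> (C + D + 1) * length (e (fst z) @ e' (snd z))" for z
  proof -
    obtain x y where z: "z = (x, y)" by (cases z)
    have "length (e x) \<noteq> 0" using p(3)[of x] dsize_pos[of x] by fastforce
    then have "dsize x + dsize y + 1 \<le> C * length (e x) + D * length (e' y) + length (e x)"
      using p(3)[of x] q(3)[of y] by linarith
    also have "\<dots> \<le> (C + D + 1) * length (e x @ e' y)" by (simp add: algebra_simps)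
    finally show ?thesis by (simp add: z)
  qed
  ultimately show ?thesis unfolding decodable_def by blast
qed

lemma fold_const_funpow: "fold (\<lambda>_. f) xs a = (f ^^ length xs) a"
  by (induction xs arbitrary: a) (auto simp: funpow_swap1)

lemma decodable_list:
  fixes e :: "'a::data \<Rightarrow> bool list"
  assumes "decodable e"
  shows "decodable (enc_list e)"
proof -
  obtain p C where p: "ptime p" "\<And>w x r. p w = Some (x, r) \<longleftrightarrow> w = e x @ r" "\<And>x. dsize x \<le> C * length (e x)"
    using assms(1) unfolding decodable_def by blast
  \<comment> \<open>The state holds the unread word, the elements read so far in reverse order, and
    whether the end of the list has been seen; \<open>None\<close> is failure.\<close>
  define step where "step st = (case st of None \<Rightarrow> None | Some t \<Rightarrow>
      if snd (snd t) then Some t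
      else (case fst t of [] \<Rightarrow> None | b # r \<Rightarrow>
        if b then (case p r of None \<Rightarrow> None | Some u \<Rightarrow> Some (snd u, fst u # fst (snd t), False))
        else Some (r, fst (snd t), True)))"
    for st :: "(bool list \<times> 'a list \<times> bool) option"
  have step_None: "step None = None" by (simp add: step_def)
  \<comment> \<open>The word itself is the clock: every step before the end consumes a symbol, and
    surplus steps leave a finished state alone.\<close>
  define d where "d w = (case fold (\<lambda>_. step) w (Some (w, [], False)) of None \<Rightarrow> None
      | Some t \<Rightarrow> if snd (snd t) then Some (rev (fst (snd t)), fst t) else None)" for w
  let ?E = "\<lambda>out. concat (map (\<lambda>x. True # e x) (rev out))"
  \<comment> \<open>The input can be reassembled from every reachable state. This yields soundness
    and also bounds the sizes, as elements and rest share the symbols of \<open>w\<close>.\<close>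
  have inv: "w = ?E out @ (if fin then [False] else []) @ rest"
    if "(step ^^ n) (Some (w, [], False)) = Some (rest, out, fin)" for n w rest out fin
    using that
  proof (induction n arbitrary: rest out fin)
    case (Suc n)
    then obtain rest' out' fin' where *: "(step ^^ n) (Some (w, [], False)) = Some (rest', out', fin')"
      by (cases "(step ^^ n) (Some (w, [], False))") (auto simp: step_None)
    have **: "step (Some (rest', out', fin')) = Some (rest, out, fin)" using Suc.prems * by simp
    show ?case
      using Suc.IH[OF *] ** p(2) by (auto simp: step_def split: if_splits list.splits option.splits)
  qed simp
  have len: "dsize out \<le> (C + 1) * length (?E out) + 1" for out
  proof (induction out)
    case (Cons x out)
    then show ?case using p(3)[of x] by (simp add: algebra_simps)
  qed simp
  have sound: "w = enc_list e xs @ r" if "d w = Some (xs, r)" for w xs r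
    using that inv[of "length w" w r "rev xs" True]
    by (auto simp: d_def fold_const_funpow enc_list_def split: option.splits if_splits)
  have run: "(step ^^ Suc (length xs)) (Some (enc_list e xs @ r, out, False)) = Some (r, rev xs @ out, True)"
    for xs r out
  proof (induction xs arbitrary: out)
    case Nil
    then show ?case by (simp add: step_def enc_list_def)
  next
    case (Cons x xs)
    have "p (e x @ enc_list e xs @ r) = Some (x, enc_list e xs @ r)" by (simp add: p(2))
    then have "step (Some (enc_list e (x # xs) @ r, out, False)) = Some (enc_list e xs @ r, x # out, False)"
      by (simp add: step_def enc_list_def)
    then show ?case using Cons.IH[of "x # out"] by (simp add: funpow_swap1)
  qed
  have stay: "(step ^^ n) (Some (r, out, True)) = Some (r, out, True)" for n r out
    by (induction n) (auto simp: step_def)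
  have complete: "d (enc_list e xs @ r) = Some (xs, r)" for xs r
  proof -
    have "length xs \<le> length (concat (map (\<lambda>x. True # e x) xs))" by (induction xs) auto
    then have "Suc (length xs) \<le> length (enc_list e xs @ r)" by (simp add: enc_list_def)
    then obtain k where k: "length (enc_list e xs @ r) = k + Suc (length xs)"
      by (metis le_add_diff_inverse2)
    have "(step ^^ length (enc_list e xs @ r)) (Some (enc_list e xs @ r, [], False)) = Some (r, rev xs, True)"
      by (simp only: k funpow_add o_apply run stay append_Nil2)
    then show ?thesis by (simp add: d_def fold_const_funpow del: length_append fold_append)
  qed
  have "ptime d"
    unfolding d_def
  proof (intro ptime_intros)
    show "ptime (\<lambda>w. fold (\<lambda>_. step) w (Some (w, [], False)))"
    proof (rule ptime_fold[where G = "\<lambda>_ _. step" and B = "\<lambda>w. (C + 2) * dsize w + 10"])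
      show "ptime (\<lambda>z :: bool list \<times> bool \<times> (bool list \<times> 'a list \<times> bool) option. step (snd (snd z)))"
        unfolding step_def by (intro ptime_intros ptime_comp[OF _ p(1)])
      fix w ys zs :: "bool list" assume w: "w = ys @ zs"
      show "dsize (fold (\<lambda>_. step) ys (Some (w, [], False))) \<le> (C + 2) * dsize w + 10"
      proof (cases "(step ^^ length ys) (Some (w, [], False))")
        case (Some t)
        obtain rest out fin where t: "t = (rest, out, fin)" by (cases t)
        have eq: "w = ?E out @ (if fin then [False] else []) @ rest" using inv Some t by blast
        have "length (?E out) \<le> length w" using arg_cong[OF eq, of length] by simp
        then have "dsize out \<le> (C + 1) * dsize w + 1"
          using len[of out] length_le_dsize[of w] by (meson add_right_mono le_trans mult_le_mono2)
        moreover have "dsize rest \<le> dsize w"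
          using dsize_append[of "?E out @ (if fin then [False] else [])" rest] eq
            dsize_pos[of "?E out @ (if fin then [False] else [])"]
          by (simp del: dsize_pos dsize_pos')
        ultimately show ?thesis using dsize_bool_le[of fin] by (simp add: fold_const_funpow Some t)
      qed (simp add: fold_const_funpow)
    qed (intro ptime_intros pbounded_intros)+
  qed
  moreover have "d w = Some (xs, r) \<longleftrightarrow> w = enc_list e xs @ r" for w xs r
    using sound complete by blast
  moreover have "dsize xs \<le> (C + 1) * length (enc_list e xs)" for xs
    using len[of "rev xs"] by (simp add: enc_list_def)
  ultimately show ?thesis unfolding decodable_def by blast
qed

lemma decodableD:
  assumes "decodable e"
  shows "\<exists>d. ptime d \<and> (\<forall>w x. d w = Some x \<longleftrightarrow> w = e x)"
proof -
  obtain p where p: "ptime p" "\<And>w x r. p w = Some (x, r) \<longleftrightarrow> w = e x @ r"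
    using assms unfolding decodable_def by blast
  let ?d = "\<lambda>w. case p w of None \<Rightarrow> None | Some u \<Rightarrow> if snd u = [] then Some (fst u) else None"
  have "ptime ?d" by (intro ptime_intros p(1))
  moreover have "?d w = Some x \<longleftrightarrow> w = e x" for w x
    using p(2)[of w x "[]"] by (auto split: option.splits if_splits)
  ultimately show ?thesis by blast
qed

section \<open>Reading the input\<close>

text \<open>A coded list has its head on top and must be built from the last element. The first loop
  therefore moves the input to stack 1 in reverse, and the second wraps each bit as a list cell
  around what is already there.\<close>

definition load_input :: com where
  "load_input =
     While 0 0 (Cond 0 2 (Push 1 2) (Push 1 1) ;; Pop 0) ;; Push 0 1 ;;
     While 1 0 (Cond 1 2 (Push 0 1 ;; Push 0 1 ;; Push 0 2) (Push 0 1) ;; Push 0 2 ;; Pop 1)"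

lemma exec_load_input:
  "exec load_input (input_stacks w) (20 * length w + 4) ((\<lambda>_. [])(0 := code (tree_of w)))"
proof -
  let ?sym = "\<lambda>b. if b then 2 else 1 :: nat"
  let ?c1 = "Cond 0 2 (Push 1 2) (Push 1 1) ;; Pop 0"
  let ?c2 = "Cond 1 2 (Push 0 1 ;; Push 0 1 ;; Push 0 2) (Push 0 1) ;; Push 0 2 ;; Pop 1"
  have 1: "exec (While 0 0 ?c1) s (7 * length w + 1) (s(0 := [], 1 := rev (map ?sym w) @ s 1))"
    if "s 0 = map ?sym w" for s w
    using that
  proof (induction w arbitrary: s)
    case Nil
    then show ?case by (intro exec_eq[OF exec_While_end]) (auto simp: fun_eq_iff)
  next
    case (Cons b w)
    have "exec (Cond 0 2 (Push 1 2) (Push 1 1)) s (2 + 2) (s(1 := ?sym b # s 1))"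
    proof (cases b)
      case True
      then show ?thesis using exec_Push[of 1 2 s] Cons.prems by (intro exec_Cond_True) auto
    next
      case False
      then show ?thesis using exec_Push[of 1 1 s] Cons.prems by (intro exec_Cond_False) auto
    qed
    from exec_Seq[OF this exec_Pop[of 0]]
    have body: "exec ?c1 s 5 (s(1 := ?sym b # s 1, 0 := map ?sym w))"
      using Cons.prems by (auto elim!: exec_eq simp: fun_eq_iff)
    have "exec (While 0 0 ?c1) s (5 + (7 * length w + 1) + 2)
      ((s(1 := ?sym b # s 1, 0 := map ?sym w))(0 := [], 1 := rev (map ?sym w) @ (s(1 := ?sym b # s 1, 0 := map ?sym w)) 1))"
      by (rule exec_While_step[OF _ _ body Cons.IH]) (use Cons.prems in auto)
    then show ?case by (rule exec_eq) (auto simp: fun_eq_iff)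
  qed
  have 2: "exec (While 1 0 ?c2) s (13 * length v + 1) (s(1 := [], 0 := code (tree_of (rev v @ u))))"
    if "s 1 = map ?sym v" "s 0 = code (tree_of u)" for s v u
    using that
  proof (induction v arbitrary: s u)
    case Nil
    then show ?case by (intro exec_eq[OF exec_While_end]) (auto simp: fun_eq_iff)
  next
    case (Cons b v)
    have "exec (Cond 1 2 (Push 0 1 ;; Push 0 1 ;; Push 0 2) (Push 0 1)) s (6 + 2)
        (s(0 := code (tree_of b) @ s 0))"
    proof (cases b)
      case True
      have "exec (Push 0 1 ;; Push 0 1 ;; Push 0 2) s 6 (s(0 := code (tree_of b) @ s 0))"
        by (rule exec_eq, rule run_Push, simp, simp, rule run_Push, simp, simp, rule exec_Push)
           (auto simp: True tree_of_bool_def fun_eq_iff)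
      then show ?thesis using Cons.prems True by (intro exec_Cond_True) auto
    next
      case False
      have "exec (Push 0 1) s 6 (s(0 := code (tree_of b) @ s 0))"
        by (rule exec_eq, rule exec_Push) (auto simp: False tree_of_bool_def fun_eq_iff)
      then show ?thesis using Cons.prems False by (intro exec_Cond_False) auto
    qed
    note body = exec_Seq[OF this run_Push[OF _ _ exec_Pop]]
    let ?s1 = "s(1 := map ?sym v, 0 := code (tree_of (b # u)))"
    have body: "exec ?c2 s 11 ?s1"
      by (rule exec_eq, rule body) (use Cons.prems in \<open>auto simp: fun_eq_iff\<close>)
    have "exec (While 1 0 ?c2) s (11 + (13 * length v + 1) + 2)
       (?s1(1 := [], 0 := code (tree_of (rev v @ b # u))))"
      by (rule exec_While_step[OF _ _ body Cons.IH]) (use Cons.prems in auto)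
    then show ?case by (rule exec_eq) (auto simp: fun_eq_iff)
  qed
  let ?s1 = "(input_stacks w)(0 := [], 1 := rev (map ?sym w) @ input_stacks w 1)"
  let ?s2 = "?s1(0 := 1 # ?s1 0)"
  have w1: "exec (While 0 0 ?c1) (input_stacks w) (7 * length w + 1) ?s1"
    by (rule 1) (simp add: input_stacks_def)
  have w2: "exec (While 1 0 ?c2) ?s2 (13 * length (rev w) + 1)
      (?s2(1 := [], 0 := code (tree_of (rev (rev w) @ []))))"
    by (rule 2) (auto simp: input_stacks_def rev_map)
  show ?thesis
    unfolding load_input_def
    by (rule exec_eq, rule exec_Seq[OF w1 run_Push[OF _ _ w2]]) (auto simp: fun_eq_iff input_stacks_def)
qed

theorem ptime_class_P:
  fixes D :: "bool list \<Rightarrow> bool"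
  assumes "ptime D" "\<And>w. D w \<longleftrightarrow> w \<in> L"
  shows "L \<in> class_P"
proof -
  obtain c b where c: "computes c D b" "pbounded b" using assms(1) unfolding ptime_def by blast
  obtain q where q: "\<And>w. b w \<le> poly q (dsize w)" using c(2) unfolding pbounded_def by blast
  \<comment> \<open>A list of n bits has size at most 4 n + 1; the second summand is the time for
    loading it.\<close>
  let ?p = "pcompose q [:1, 4:] + [:4, 20:]"
  have "\<exists>s'. exec (load_input ;; c) (input_stacks w) (poly ?p (length w)) s' \<and> (peek (s' 0) = 2 \<longleftrightarrow> w \<in> L)" for w
  proof -
    let ?s1 = "(\<lambda>_. [])(0 := code (tree_of w))"
    let ?s2 = "?s1(0 := code (tree_of (D w)) @ [])"
    have "exec c ?s1 (b w) ?s2" by (rule computesD[OF c(1)]) simp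
    note run = exec_Seq[OF exec_load_input this]
    have "b w \<le> poly q (4 * length w + 1)"
      using q[of w] poly_nat_mono[OF dsize_bools, of q w] le_trans by blast
    then have "exec (load_input ;; c) (input_stacks w) (poly ?p (length w)) ?s2"
      by (intro exec_weaken[OF run]) (simp add: poly_pcompose algebra_simps)
    moreover have "peek (?s2 0) = 2 \<longleftrightarrow> w \<in> L"
      using assms(2)[of w] by (auto simp: tree_of_bool_def)
    ultimately show ?thesis by blast
  qed
  then show ?thesis by (rule class_P_I)
qed


section \<open>Implementability as a system of difference constraints\<close>

text \<open>For necessity, a type is charged the payment of its bid in one fixed equilibrium. For
  sufficiency, the types themselves are the bids, which is possible because they are natural
  numbers. Applied in both directions, the weak inequality forces equal payments for equal
  outcomes.\<close>

lemma strongly_implementable_iff: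
  fixes \<Theta> :: "nat set"
  assumes "\<And>\<theta>. \<theta> \<in> \<Theta> \<Longrightarrow> f \<theta> \<in> X"
  shows "strongly_implementable X \<Theta> V f \<longleftrightarrow>
    (\<exists>p. \<forall>\<theta>\<in>\<Theta>. \<forall>\<theta>'\<in>\<Theta>. if f \<theta> = f \<theta>' then p \<theta>' \<le> p \<theta> else p \<theta>' - p \<theta> < V (f \<theta>) \<theta> - V (f \<theta>') \<theta>)"
    (is "_ \<longleftrightarrow> ?R")
proof
  assume "strongly_implementable X \<Theta> V f"
  then obtain \<Gamma> :: "(nat, 'a) mechanism" where \<Gamma>: "strongly_implements X \<Theta> V f \<Gamma>"
    unfolding strongly_implementable_def by blast
  then obtain \<alpha> where eq: "equilibrium \<Theta> V \<Gamma> \<alpha>" unfolding strongly_implements_def by blast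
  have out: "outcome \<Gamma> (\<beta> \<theta>) = f \<theta>" if "equilibrium \<Theta> V \<Gamma> \<beta>" "\<theta> \<in> \<Theta>" for \<beta> \<theta>
    using \<Gamma> that unfolding strongly_implements_def by blast
  show ?R
  proof (intro exI[of _ "\<lambda>\<theta>. payment \<Gamma> (\<alpha> \<theta>)"] ballI)
    fix \<theta> \<theta>' assume t: "\<theta> \<in> \<Theta>" "\<theta>' \<in> \<Theta>"
    have le: "utility V \<Gamma> (\<alpha> \<theta>') \<theta> \<le> utility V \<Gamma> (\<alpha> \<theta>) \<theta>"
      using eq t unfolding equilibrium_def strategy_def by blast
    have "utility V \<Gamma> (\<alpha> \<theta>') \<theta> \<noteq> utility V \<Gamma> (\<alpha> \<theta>) \<theta>" if "f \<theta> \<noteq> f \<theta>'"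
    proof
      assume "utility V \<Gamma> (\<alpha> \<theta>') \<theta> = utility V \<Gamma> (\<alpha> \<theta>) \<theta>"
      \<comment> \<open>On a tie, switching \<theta> to the bid of \<theta>' gives a second
        equilibrium, whose outcome at \<theta> would be \<open>f \<theta>'\<close>.\<close>
      then have "equilibrium \<Theta> V \<Gamma> (\<alpha>(\<theta> := \<alpha> \<theta>'))"
        using eq t unfolding equilibrium_def strategy_def by auto
      from out[OF this t(1)] out[OF eq t(2)] that show False by simp
    qed
    with le show "if f \<theta> = f \<theta>' then payment \<Gamma> (\<alpha> \<theta>') \<le> payment \<Gamma> (\<alpha> \<theta>)
        else payment \<Gamma> (\<alpha> \<theta>') - payment \<Gamma> (\<alpha> \<theta>) < V (f \<theta>) \<theta> - V (f \<theta>') \<theta>"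
      using out[OF eq t(1)] out[OF eq t(2)] by (auto simp: utility_def)
  qed
next
  assume ?R
  then obtain p where p: "\<And>\<theta> \<theta>'. \<theta> \<in> \<Theta> \<Longrightarrow> \<theta>' \<in> \<Theta> \<Longrightarrow>
    if f \<theta> = f \<theta>' then p \<theta>' \<le> p \<theta> else p \<theta>' - p \<theta> < V (f \<theta>) \<theta> - V (f \<theta>') \<theta>" by blast
  define \<Gamma> where "\<Gamma> = \<lparr>bids = \<Theta>, outcome = f, payment = p\<rparr>"
  have "equilibrium \<Theta> V \<Gamma> (\<lambda>\<theta>. \<theta>)"
    unfolding equilibrium_def strategy_def
  proof (intro conjI ballI)
    fix \<theta> s assume "\<theta> \<in> \<Theta>" "s \<in> bids \<Gamma>"
    with p[of \<theta> s] show "utility V \<Gamma> s \<theta> \<le> utility V \<Gamma> \<theta> \<theta>"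
      by (auto simp: \<Gamma>_def utility_def split: if_splits)
  qed (simp add: \<Gamma>_def)
  moreover have "outcome \<Gamma> (\<alpha> \<theta>) = f \<theta>" if "equilibrium \<Theta> V \<Gamma> \<alpha>" "\<theta> \<in> \<Theta>" for \<alpha> \<theta>
  proof (rule ccontr)
    assume "outcome \<Gamma> (\<alpha> \<theta>) \<noteq> f \<theta>"
    moreover have "\<alpha> \<theta> \<in> \<Theta>" "utility V \<Gamma> \<theta> \<theta> \<le> utility V \<Gamma> (\<alpha> \<theta>) \<theta>"
      using that unfolding equilibrium_def strategy_def \<Gamma>_def by auto
    ultimately show False
      using p[OF that(2), of "\<alpha> \<theta>"] by (auto simp: \<Gamma>_def utility_def split: if_splits)
  qed
  moreover have "mechanism_on X \<Gamma>" using assms by (simp add: mechanism_on_def \<Gamma>_def)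
  ultimately have "strongly_implements X \<Theta> V f \<Gamma>" unfolding strongly_implements_def by blast
  then show "strongly_implementable X \<Theta> V f" unfolding strongly_implementable_def by blast
qed


text \<open>A weight \<open>((p, n), strict)\<close> stands for the upper bound \<open>p - n\<close>, so that subtraction of
  binary numbers is never needed.\<close>

type_synonym weight = "(bool list \<times> bool list) \<times> bool"

definition ival :: "bool list \<times> bool list \<Rightarrow> int" where
  "ival z = int (bval (fst z)) - int (bval (snd z))"

definition admits :: "weight \<Rightarrow> rat \<Rightarrow> bool" where
  "admits w d \<longleftrightarrow> (if snd w then d < of_int (ival (fst w)) else d \<le> of_int (ival (fst w)))"

definition wadd :: "weight \<Rightarrow> weight \<Rightarrow> weight" where
  "wadd v w = ((badd (fst (fst v)) (fst (fst w)), badd (snd (fst v)) (snd (fst w))), snd v \<or> snd w)"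

text \<open>Differences are compared by adding crosswise. Equal values need care: the tie goes to
  \<open>v\<close> if \<open>v\<close> is strict and to \<open>w\<close> otherwise, so strictness on
  either side survives.\<close>

definition wmin :: "weight \<Rightarrow> weight \<Rightarrow> weight" where
  "wmin v w =
    (if (if snd v
        then bval (badd (fst (fst v)) (snd (fst w))) \<le> bval (badd (fst (fst w)) (snd (fst v)))
        else bval (badd (fst (fst v)) (snd (fst w))) < bval (badd (fst (fst w)) (snd (fst v))))
     then v else w)"

definition wnonneg :: "weight \<Rightarrow> bool" where
  "wnonneg w \<longleftrightarrow> (if snd w then bval (snd (fst w)) < bval (fst (fst w)) else bval (snd (fst w)) \<le> bval (fst (fst w)))"

lemma ival_wadd: "ival (fst (wadd v w)) = ival (fst v) + ival (fst w)"
  and snd_wadd: "snd (wadd v w) \<longleftrightarrow> snd v \<or> snd w"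
  by (simp_all add: wadd_def ival_def)

lemma admits_wmin: "admits (wmin v w) d \<longleftrightarrow> admits v d \<and> admits w d"
proof -
  define a b :: rat where "a = of_int (ival (fst v))" and "b = of_int (ival (fst w))"
  have "ival (fst v) \<le> ival (fst w) \<longleftrightarrow> a \<le> b" "ival (fst v) < ival (fst w) \<longleftrightarrow> a < b"
    by (simp_all add: a_def b_def)
  then have "wmin v w = (if (if snd v then a \<le> b else a < b) then v else w)"
    by (auto simp: wmin_def ival_def)
  moreover have "admits v d \<longleftrightarrow> (if snd v then d < a else d \<le> a)" "admits w d \<longleftrightarrow> (if snd w then d < b else d \<le> b)"
    by (simp_all add: admits_def a_def b_def)
  ultimately show ?thesis by (cases "snd v"; cases "snd w") auto
qed

lemma wnonneg_iff: "wnonneg w \<longleftrightarrow> admits w 0"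
  by (auto simp: wnonneg_def admits_def ival_def)

definition feasible :: "weight list list \<Rightarrow> bool" where
  "feasible M \<longleftrightarrow> (\<exists>q. \<forall>i<length M. \<forall>j<length M. admits (M ! i ! j) (q j - q i))"

text \<open>\<open>r\<close> is the row of the eliminated node without its diagonal entry, and
  \<open>hd row\<close> is the bound on the step from the node of \<open>row\<close> to the
  eliminated one. Its row and column disappear, so the matrix shrinks.\<close>

definition eliminate :: "weight list \<Rightarrow> weight list list \<Rightarrow> weight list list" where
  "eliminate r rows = map (\<lambda>row. map (\<lambda>z. wmin (fst z) (wadd (hd row) (snd z))) (zip (tl row) r)) rows"

text \<open>Only the largest lower and the smallest upper bound matter. If they differ, their
  midpoint satisfies even the strict bounds; this is where divisibility in the rationals is
  used.\<close>

lemma exists_between: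
  fixes l u :: "nat \<Rightarrow> rat"
  assumes "\<And>i j. i < n \<Longrightarrow> j < n \<Longrightarrow> if s i \<or> t j then l j < u i else l j \<le> u i"
  shows "\<exists>z. \<forall>i<n. (if s i then z < u i else z \<le> u i) \<and> (if t i then l i < z else l i \<le> z)"
proof (cases "n = 0")
  case False
  then have ne: "finite (l ` {..<n})" "l ` {..<n} \<noteq> {}" "finite (u ` {..<n})" "u ` {..<n} \<noteq> {}" by auto
  define L U where "L = Max (l ` {..<n})" and "U = Min (u ` {..<n})"
  obtain j0 where j0: "j0 < n" "l j0 = L" using Max_in[OF ne(1,2)] by (auto simp: L_def)
  obtain i0 where i0: "i0 < n" "u i0 = U" using Min_in[OF ne(3,4)] by (auto simp: U_def)
  have L: "l i \<le> L" and U: "U \<le> u i" if "i < n" for i using that ne by (auto simp: L_def U_def)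
  have "L \<le> U" using assms[OF i0(1) j0(1)] i0 j0 by (auto split: if_splits)
  show ?thesis
  proof (cases "L = U")
    case True
    \<comment> \<open>The point is now forced. A strict bound at \<open>i\<close> follows by pairing
      \<open>i\<close> with an index that attains the opposite extreme.\<close>
    have "(if s i then L < u i else L \<le> u i) \<and> (if t i then l i < L else l i \<le> L)" if "i < n" for i
      using assms[OF that j0(1)] assms[OF i0(1) that] i0(2) j0(2) True by (auto split: if_splits)
    then show ?thesis by blast
  next
    case False
    then have lt: "L < (L + U) / 2" "(L + U) / 2 < U" using \<open>L \<le> U\<close> by auto
    have "l i < (L + U) / 2" "(L + U) / 2 < u i" if "i < n" for i
      using L[OF that] U[OF that] lt by linarith+
    then show ?thesis by (intro exI[of _ "(L + U) / 2"]) (auto simp: less_imp_le)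
  qed
qed simp

text \<open>Node 0 can be placed iff all its lower bounds are compatible with all its upper bounds.\<close>

lemma feasible_eliminate:
  assumes sq: "\<forall>row\<in>set ((d # r) # rows). length row = Suc (length rows)"
  shows "feasible ((d # r) # rows) \<longleftrightarrow> wnonneg d \<and> feasible (eliminate r rows)"
proof -
  let ?n = "length rows" and ?M = "(d # r) # rows" and ?E = "eliminate r rows"
  have len: "length ?E = ?n" "length r = ?n" using sq by (auto simp: eliminate_def)
  have row: "rows ! i = hd (rows ! i) # tl (rows ! i)" "length (tl (rows ! i)) = ?n" if "i < ?n" for i
  proof -
    have "length (rows ! i) = Suc ?n" using sq that by auto
    then show "rows ! i = hd (rows ! i) # tl (rows ! i)" "length (tl (rows ! i)) = ?n"
      by (cases "rows ! i"; simp)+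
  qed
  have nth: "?E ! i ! j = wmin (rows ! i ! Suc j) (wadd (rows ! i ! 0) (r ! j))" if "i < ?n" "j < ?n" for i j
    using that row[of i] len by (simp add: eliminate_def) (metis nth_Cons_0 nth_Cons_Suc)
  \<comment> \<open>The bound through the eliminated node says precisely that a lower bound for its
    value is compatible with an upper bound, the form that \<open>exists_between\<close>
    expects.\<close>
  have wadd_iff: "admits (wadd c v) (x - y) \<longleftrightarrow>
      (if snd c \<or> snd v then x - of_int (ival (fst v)) < y + of_int (ival (fst c))
       else x - of_int (ival (fst v)) \<le> y + of_int (ival (fst c)))" for c v x y
    by (auto simp: admits_def ival_wadd snd_wadd algebra_simps)
  show ?thesis
  proof
    assume "feasible ?M"
    then obtain q where q: "\<And>i j. i < Suc ?n \<Longrightarrow> j < Suc ?n \<Longrightarrow> admits (?M ! i ! j) (q j - q i)"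
      by (auto simp: feasible_def)
    have "wnonneg d" using q[of 0 0] by (simp add: wnonneg_iff)
    moreover have "admits (?E ! i ! j) (q (Suc j) - q (Suc i))" if "i < ?n" "j < ?n" for i j
    proof -
      have "admits (rows ! i ! 0) (q 0 - q (Suc i))" "admits (r ! j) (q (Suc j) - q 0)"
        using q[of "Suc i" 0] q[of 0 "Suc j"] that by auto
      then have "admits (wadd (rows ! i ! 0) (r ! j)) (q (Suc j) - q (Suc i))"
        unfolding wadd_iff by (auto simp: admits_def split: if_splits)
      then show ?thesis using q[of "Suc i" "Suc j"] that by (simp add: nth admits_wmin)
    qed
    ultimately show "wnonneg d \<and> feasible ?E"
      unfolding feasible_def len by (auto intro!: exI[of _ "\<lambda>i. q (Suc i)"])
  next
    assume *: "wnonneg d \<and> feasible ?E"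
    then obtain q where q: "\<And>i j. i < ?n \<Longrightarrow> j < ?n \<Longrightarrow> admits (?E ! i ! j) (q j - q i)"
      by (auto simp: feasible_def len)
    have "\<exists>z. \<forall>i<?n. (if snd (rows ! i ! 0) then z < q i + of_int (ival (fst (rows ! i ! 0)))
          else z \<le> q i + of_int (ival (fst (rows ! i ! 0)))) \<and>
        (if snd (r ! i) then q i - of_int (ival (fst (r ! i))) < z else q i - of_int (ival (fst (r ! i))) \<le> z)"
    proof (rule exists_between)
      fix i j assume "i < ?n" "j < ?n"
      with q[of i j] have "admits (wadd (rows ! i ! 0) (r ! j)) (q j - q i)"
        by (simp add: nth admits_wmin)
      then show "if snd (rows ! i ! 0) \<or> snd (r ! j)
          then q j - of_int (ival (fst (r ! j))) < q i + of_int (ival (fst (rows ! i ! 0)))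
          else q j - of_int (ival (fst (r ! j))) \<le> q i + of_int (ival (fst (rows ! i ! 0)))"
        unfolding wadd_iff .
    qed
    then obtain z where "\<And>i. i < ?n \<Longrightarrow> (if snd (rows ! i ! 0) then z < q i + of_int (ival (fst (rows ! i ! 0)))
          else z \<le> q i + of_int (ival (fst (rows ! i ! 0)))) \<and>
        (if snd (r ! i) then q i - of_int (ival (fst (r ! i))) < z else q i - of_int (ival (fst (r ! i))) \<le> z)"
      by blast
    then have z: "admits (rows ! i ! 0) (z - q i) \<and> admits (r ! i) (q i - z)" if "i < ?n" for i
      using that unfolding admits_def by (fastforce simp: algebra_simps)
    \<comment> \<open>\<open>case_nat z q\<close> gives node 0 its new value and shifts the solution
      of the smaller system by one.\<close>
    have "admits (?M ! i ! j) (case_nat z q j - case_nat z q i)" if "i < Suc ?n" "j < Suc ?n" for i j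
      using that * z q
      by (cases i; cases j) (auto simp: wnonneg_iff nth admits_wmin)
    then show "feasible ?M" unfolding feasible_def by (intro exI[of _ "case_nat z q"]) simp
  qed
qed

definition elim_step :: "bool \<times> weight list list \<Rightarrow> bool \<times> weight list list" where
  "elim_step st = (case snd st of [] \<Rightarrow> st | row # rows \<Rightarrow>
     (case row of [] \<Rightarrow> st | d # r \<Rightarrow> (fst st \<and> wnonneg d, eliminate r rows)))"

text \<open>The matrix is its own clock, one elimination per row. The flag collects the tests of the
  diagonal entries at the moment each node is removed.\<close>

definition decide_feasible :: "weight list list \<Rightarrow> bool" where
  "decide_feasible M = fst (fold (\<lambda>_. elim_step) M (True, M))"

lemma decide_feasible:
  assumes "\<forall>row\<in>set M. length row = length M"
  shows "decide_feasible M \<longleftrightarrow> feasible M"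
proof -
  have "fst ((elim_step ^^ n) (ok, M)) \<longleftrightarrow> ok \<and> feasible M"
    if "length M = n" "\<forall>row\<in>set M. length row = length M" for n ok M
    using that
  proof (induction n arbitrary: ok M)
    case 0
    then show ?case by (simp add: feasible_def)
  next
    case (Suc n)
    then obtain d r rows where M: "M = (d # r) # rows" by (metis length_Suc_conv list.set_intros(1))
    have "\<forall>row\<in>set (eliminate r rows). length row = length (eliminate r rows)"
      using Suc.prems by (auto simp: eliminate_def M)
    then have "fst ((elim_step ^^ n) (ok \<and> wnonneg d, eliminate r rows))
        \<longleftrightarrow> (ok \<and> wnonneg d) \<and> feasible (eliminate r rows)"
      using Suc by (intro Suc.IH) (auto simp: M eliminate_def)
    moreover have "elim_step (ok, M) = (ok \<and> wnonneg d, eliminate r rows)"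
      by (simp add: elim_step_def M)
    ultimately show ?case
      using feasible_eliminate[of d r rows] Suc.prems by (simp add: funpow_swap1 M)
  qed
  from this[OF refl assms] show ?thesis by (simp add: decide_feasible_def fold_const_funpow)
qed


section \<open>The decision procedure\<close>

text \<open>On the empty list the value is the fixed element \<open>hd []\<close>, computed as a
  constant.\<close>

lemma ptime_hd: "ptime g \<Longrightarrow> ptime (\<lambda>s. hd (g s))"
  by (rule ptime_cong[OF ptime_case_list[where L = g and A = "\<lambda>_. hd []" and B = "\<lambda>_ x xs. x"]])
     (auto intro!: ptime_base split: list.split)

lemma ptime_eliminate:
  "ptime f \<Longrightarrow> ptime g \<Longrightarrow> ptime (\<lambda>s. eliminate (f s) (g s))"
proof (rule ptime_comp2[where h = eliminate])
  show "ptime (\<lambda>z. eliminate (fst z) (snd z))"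
    unfolding eliminate_def wmin_def wadd_def
    by (intro ptime_intros ptime_badd ptime_ble ptime_blt ptime_hd)
qed

lemma ptime_elim_step: "ptime elim_step"
  unfolding elim_step_def wnonneg_def
  by (intro ptime_intros ptime_eliminate ptime_ble ptime_blt)

section \<open>Growth of the numbers during elimination\<close>

definition small :: "nat \<Rightarrow> nat \<Rightarrow> weight list list \<Rightarrow> bool" where
  "small n l M \<longleftrightarrow> length M \<le> n \<and> (\<forall>row\<in>set M. length row \<le> n \<and>
     (\<forall>w\<in>set row. length (fst (fst w)) \<le> l \<and> length (snd (fst w)) \<le> l))"

text \<open>A new entry is an old entry or the sum of two entries from before the step, never a sum
  of fresh sums; so a single carry separates new lengths from old. The dimensions do not
  grow.\<close>

lemma small_elim_step:
  assumes "small n l (snd st)"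
  shows "small n (Suc l) (snd (elim_step st))"
proof -
  have "snd (elim_step st) = snd st \<or>
      (\<exists>d r rows. snd st = (d # r) # rows \<and> snd (elim_step st) = eliminate r rows)"
    by (cases "snd st"; cases "hd (snd st)") (simp_all add: elim_step_def)
  then consider "snd (elim_step st) = snd st" | d r rows where "snd st = (d # r) # rows"
    "snd (elim_step st) = eliminate r rows"
    by blast
  then show ?thesis
  proof cases
    case 1
    then show ?thesis using assms by (fastforce simp: small_def)
  next
    case 2
    have *: "length (fst (fst w)) \<le> l \<and> length (snd (fst w)) \<le> l"
      if "row \<in> set ((d # r) # rows)" "w \<in> set row" for row w
      using assms that unfolding small_def 2 by blast
    have "length (fst (fst w)) \<le> Suc l \<and> length (snd (fst w)) \<le> Suc l"
      if row: "row \<in> set rows" and z: "z \<in> set (zip (tl row) r)" and w: "w = wmin (fst z) (wadd (hd row) (snd z))"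
      for row z w
    proof -
      obtain a as where row': "row = a # as" using z by (cases row) auto
      have in': "fst z \<in> set row" "hd row \<in> set row" "snd z \<in> set (d # r)"
        using z row' set_zip_leftD[of "fst z" "snd z" as r] set_zip_rightD[of "fst z" "snd z" as r] by auto
      have "w = fst z \<or> w = wadd (hd row) (snd z)" by (simp add: w wmin_def)
      moreover have "length (fst (fst (wadd (hd row) (snd z)))) \<le> Suc l \<and> length (snd (fst (wadd (hd row) (snd z)))) \<le> Suc l"
        using *[of row "hd row"] *[of "d # r" "snd z"] in' row
          length_badd[of "fst (fst (hd row))" "fst (fst (snd z))"] length_badd[of "snd (fst (hd row))" "snd (fst (snd z))"]
        by (auto simp: wadd_def)
      ultimately show ?thesis using *[of row "fst z"] in' row by auto
    qed
    then have "\<forall>row\<in>set (eliminate r rows). \<forall>w\<in>set row. length (fst (fst w)) \<le> Suc l \<and> length (snd (fst w)) \<le> Suc l"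
      unfolding eliminate_def by auto
    moreover have "length (eliminate r rows) \<le> n" "\<forall>row\<in>set (eliminate r rows). length row \<le> n"
      using assms unfolding small_def 2 by (auto simp: eliminate_def min.coboundedI2)
    ultimately show ?thesis unfolding small_def 2(2) by blast
  qed
qed

lemma dsize_small:
  assumes "small n l M"
  shows "dsize M \<le> 1 + n * (1 + n * (8 * l + 9) + 1)"
proof (rule dsize_list_le)
  fix row assume row: "row \<in> set M"
  show "dsize row \<le> 1 + n * (8 * l + 9)"
  proof (rule order_trans[OF dsize_list_le[where N = n]])
    fix w assume w: "w \<in> set row"
    obtain p m s where "w = ((p, m), s)" by (metis surj_pair)
    moreover from this have "length p \<le> l" "length m \<le> l" using assms row w unfolding small_def by force+
    ultimately show "dsize w \<le> 8 * l + 8"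
      using dsize_bools_le[of p l] dsize_bools_le[of m l] dsize_bool_le[of s] by simp
  qed (use assms row in \<open>auto simp: small_def\<close>)
qed (use assms in \<open>auto simp: small_def\<close>)

lemma small_dsize: "small (dsize M) (dsize M) M"
  unfolding small_def
proof (intro conjI ballI)
  fix row assume "row \<in> set M"
  then have row: "dsize row \<le> dsize M" by (rule dsize_elem_le)
  then show "length row \<le> dsize M" using length_le_dsize[of row] by linarith
  fix w assume "w \<in> set row"
  then have "dsize w \<le> dsize M" using row dsize_elem_le le_trans by blast
  moreover obtain p m s where "w = ((p, m), s)" by (metis surj_pair)
  ultimately show "length (fst (fst w)) \<le> dsize M" "length (snd (fst w)) \<le> dsize M"
    using length_le_dsize[of p] length_le_dsize[of m] by auto
qed (rule length_le_dsize)

lemma ptime_decide_feasible: "ptime decide_feasible"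
  unfolding decide_feasible_def
proof (intro ptime_fst ptime_fold[where G = "\<lambda>_ _. elim_step"
      and B = "\<lambda>M. dsize M * (1 + dsize M * (8 * (dsize M + dsize M) + 9) + 1) + 5"])
  show "ptime (\<lambda>z :: weight list list \<times> weight list \<times> bool \<times> weight list list. elim_step (snd (snd z)))"
    by (intro ptime_comp[OF _ ptime_elim_step] ptime_intros)
  fix M ys zs :: "weight list list" assume M: "M = ys @ zs"
  have small: "small (dsize M) (dsize M + k) (snd ((elim_step ^^ k) (True, M)))" for k
    by (induction k) (auto simp: small_dsize intro: small_elim_step)
  have "length ys \<le> dsize M" using length_le_dsize[of M] M by simp
  \<comment> \<open>There are at most \<open>dsize M\<close> digits initially, and at most
    \<open>dsize M\<close> eliminations add one each.\<close>
  then have "small (dsize M) (dsize M + dsize M) (snd (fold (\<lambda>_. elim_step) ys (True, M)))"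
    using small[of "length ys"] unfolding fold_const_funpow small_def by fastforce
  from dsize_small[OF this]
  show "dsize (fold (\<lambda>_. elim_step) ys (True, M))
      \<le> dsize M * (1 + dsize M * (8 * (dsize M + dsize M) + 9) + 1) + 5"
    using dsize_bool_le[of "fst (fold (\<lambda>_. elim_step) ys (True, M))"]
    by (cases "fold (\<lambda>_. elim_step) ys (True, M)") simp
qed (intro ptime_intros pbounded_intros)+


text \<open>Sign, numerator, denominator; the binary digits need not be canonical.\<close>

type_synonym frac = "bool \<times> bool list \<times> bool list"

primrec remove_val :: "bool list \<Rightarrow> bool list list \<Rightarrow> bool list list" where
  "remove_val b [] = []"
| "remove_val b (x # xs) = (if bval x = bval b then xs else x # remove_val b xs)"

lemma prod_remove_val:
  "b \<in> set xs \<Longrightarrow> bval b * prod_list (map bval (remove_val b xs)) = prod_list (map bval xs)"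
  by (induction xs) (auto simp: algebra_simps)

lemma ptime_remove_val: "ptime f \<Longrightarrow> ptime g \<Longrightarrow> ptime (\<lambda>s. remove_val (f s) (g s))"
proof (rule ptime_primrec[where f = remove_val and A = "\<lambda>_. []"
      and F = "\<lambda>b x xs r. if bval x = bval b then xs else x # r" and B = dsize])
  fix b xs
  show "dsize (remove_val b xs) \<le> dsize (b, xs)"
  proof (induction xs)
    case (Cons x xs)
    then show ?case by simp
  qed simp
qed (intro ptime_intros ptime_beq pbounded_intros | simp)+

definition denominators :: "frac list list \<Rightarrow> bool list list" where
  "denominators tab = concat (map (map (\<lambda>z. snd (snd z))) tab)"

text \<open>The product of all other denominators takes the place of a division.\<close>

definition scale :: "bool list list \<Rightarrow> frac \<Rightarrow> bool list \<times> bool list" where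
  "scale dens z =
    (if fst z then ([], bmul (fst (snd z)) (bprod (remove_val (snd (snd z)) dens)))
     else (bmul (fst (snd z)) (bprod (remove_val (snd (snd z)) dens)), []))"

definition scaled :: "frac list list \<Rightarrow> (bool list \<times> bool list) list list" where
  "scaled tab = map (map (scale (denominators tab))) tab"

lemma ptime_scaled: "ptime f \<Longrightarrow> ptime (\<lambda>s. scaled (f s))"
proof (rule ptime_comp[where g = scaled])
  show "ptime scaled"
    unfolding scaled_def scale_def denominators_def
    by (intro ptime_intros ptime_bmul ptime_bprod ptime_remove_val)
qed

text \<open>The first column is removed from all rows after each type, so the current type is always
  at the head of a row and only the row has to be looked up; no column index is needed.\<close>

definition own_step :: "bool list \<Rightarrow> 'a list list \<times> (bool list \<times> 'a) list \<Rightarrow> 'a list list \<times> (bool list \<times> 'a) list" where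
  "own_step x a = (map tl (fst a), (x, hd (hd (lookup (fst a) x))) # snd a)"

definition own_values :: "'a list list \<Rightarrow> bool list list \<Rightarrow> (bool list \<times> 'a) list" where
  "own_values Z f = rev (snd (fold own_step f (Z, [])))"

lemma own_values:
  assumes "\<forall>row\<in>set Z. length row = length f" "\<forall>x\<in>set f. bval x < length Z"
  shows "own_values Z f = map (\<lambda>i. (f ! i, Z ! bval (f ! i) ! i)) [0..<length f]"
proof -
  have "fold own_step ys (Z, []) =
      (map (drop (length ys)) Z, rev (map (\<lambda>i. (f ! i, Z ! bval (f ! i) ! i)) [0..<length ys]))"
    if "f = ys @ zs" for ys zs
    using that
  proof (induction ys arbitrary: zs rule: rev_induct)
    case (snoc y ys)
    let ?Z = "map (drop (length ys)) Z"
    have y: "f ! length ys = y" "y \<in> set f" using snoc.prems by (auto simp: nth_append)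
    then have "bval y < length Z" using assms by auto
    then have "lookup ?Z y \<noteq> []" "lookup ?Z y ! 0 = drop (length ys) (Z ! bval y)"
      using lookup(1)[of ?Z y] lookup(2)[of y ?Z] by auto
    then have "hd (hd (lookup ?Z y)) = Z ! bval y ! length ys"
      using assms(1) \<open>bval y < length Z\<close> snoc.prems by (simp add: hd_conv_nth[symmetric] hd_drop_conv_nth)
    then show ?case using snoc by (simp add: own_step_def[of y] y drop_Suc tl_drop comp_def)
  qed (simp add: map_idI)
  from this[of f "[]"] show ?thesis by (simp add: own_values_def)
qed

lemma ptime_own_values:
  fixes Z :: "'s::data \<Rightarrow> 'a::data list list"
  assumes "ptime Z" "ptime f" shows "ptime (\<lambda>s. own_values (Z s) (f s))"
proof -
  \<comment> \<open>Out of range the value is a default that need not occur in the table. Its size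
    is therefore bounded through \<open>ptime\<close> and not through membership.\<close>
  have "ptime (\<lambda>z :: 'a list list \<times> bool list. hd (hd (lookup (fst z) (snd z))))"
    by (intro ptime_hd ptime_lookup ptime_intros)
  then obtain q where q: "\<And>Z x. dsize (hd (hd (lookup Z x)) :: 'a) \<le> poly q (dsize (Z, x))"
    using ptime_pbounded unfolding pbounded_def by fastforce
  let ?D = "\<lambda>Z f. dsize f + poly q (dsize Z + dsize f + 1) + 1"
  have dsize_tl: "dsize (map tl Z) \<le> dsize Z" for Z :: "'a list list"
  proof (induction Z)
    case (Cons z Z)
    then show ?case using dsize_drop[of 1 z] by (simp add: drop_Suc)
  qed simp
  have inv: "dsize (fst (fold own_step ys (Z, []))) \<le> dsize Z
      \<and> length (snd (fold own_step ys (Z, []))) = length ys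
      \<and> (\<forall>u\<in>set (snd (fold own_step ys (Z, []))). dsize u \<le> ?D Z f)"
    if "f = ys @ zs" for ys zs f and Z :: "'a list list"
    using that
  proof (induction ys arbitrary: zs rule: rev_induct)
    case (snoc y ys)
    let ?a = "fold own_step ys (Z, [])"
    have IH: "dsize (fst ?a) \<le> dsize Z" "length (snd ?a) = length ys" "\<forall>u\<in>set (snd ?a). dsize u \<le> ?D Z f"
      using snoc by auto
    have y: "dsize y \<le> dsize f" by (rule dsize_elem_le) (simp add: snoc.prems)
    have "dsize (hd (hd (lookup (fst ?a) y))) \<le> poly q (dsize Z + dsize f + 1)"
      using q[of "fst ?a" y] poly_nat_mono[of "dsize (fst ?a, y)" "dsize Z + dsize f + 1" q] IH(1) y by simp
    then have "dsize (y, hd (hd (lookup (fst ?a) y))) \<le> ?D Z f" using y by simp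
    then show ?case using IH dsize_tl[of "fst ?a"] by (simp add: own_step_def[of y])
  qed simp
  have "ptime (\<lambda>s. fold own_step (f s) (Z s, []))"
  proof (rule ptime_fold[where G = "\<lambda>_. own_step"
        and B = "\<lambda>s. dsize (Z s) + (1 + dsize (f s) * (?D (Z s) (f s) + 1)) + 1"])
    fix s ys zs assume s: "f s = ys @ zs"
    note inv = inv[OF s, of "Z s"]
    have "length ys \<le> dsize (f s)" using length_le_dsize[of "f s"] s by simp
    then have "dsize (snd (fold own_step ys (Z s, []))) \<le> 1 + dsize (f s) * (?D (Z s) (f s) + 1)"
      using inv by (intro dsize_list_le) auto
    then show "dsize (fold own_step ys (Z s, [])) \<le> dsize (Z s) + (1 + dsize (f s) * (?D (Z s) (f s) + 1)) + 1"
      using inv by (cases "fold own_step ys (Z s, [])") simp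
  next
    show "ptime (\<lambda>z :: 's \<times> bool list \<times> 'a list list \<times> (bool list \<times> 'a) list. own_step (fst (snd z)) (snd (snd z)))"
      unfolding own_step_def by (intro ptime_hd ptime_lookup ptime_intros)
  qed (intro ptime_intros assms pbounded_intros assms[THEN ptime_pbounded])+
  then show ?thesis unfolding own_values_def by (intro ptime_intros)
qed

text \<open>Entry \<open>(\<theta>', \<theta>)\<close> belongs to the incentive constraint of type \<open>\<theta>\<close> against reporting \<open>\<theta>'\<close>; this is
  transposed, so the payments are the negated solutions of the system, up to the common denominator.\<close>

definition weights :: "(bool list \<times> bool list) list list \<Rightarrow> bool list list \<Rightarrow> weight list list" where
  "weights Z f = map (\<lambda>x. map (\<lambda>z. if bval (fst (fst z)) = bval x then (([], []), False)
      else ((badd (fst (snd (fst z))) (snd (snd z)), badd (snd (snd (fst z))) (fst (snd z))), True))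
    (zip (own_values Z f) (hd (lookup Z x)))) f"

lemma ptime_weights: "ptime g \<Longrightarrow> ptime h \<Longrightarrow> ptime (\<lambda>s. weights (g s) (h s))"
proof (rule ptime_comp2[where h = weights])
  show "ptime (\<lambda>z. weights (fst z) (snd z))"
    unfolding weights_def
    by (intro ptime_own_values ptime_lookup ptime_hd ptime_badd ptime_beq ptime_intros)
qed

lemma weights_square:
  assumes "\<forall>row\<in>set Z. length row = length f" "\<forall>x\<in>set f. bval x < length Z"
  shows "\<forall>row\<in>set (weights Z f). length row = length (weights Z f)"
proof -
  have "length (hd (lookup Z x)) = length f" if "x \<in> set f" for x
    using assms that lookup(1)[of Z x] lookup(2)[of x Z] by (auto simp: hd_conv_nth)
  then show ?thesis using assms by (auto simp: weights_def own_values)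
qed

lemma weights_feasible:
  assumes Z: "\<forall>row\<in>set Z. length row = length f" "\<forall>x\<in>set f. bval x < length Z"
  shows "feasible (weights Z f) \<longleftrightarrow> (\<exists>q :: nat \<Rightarrow> rat. \<forall>i<length f. \<forall>j<length f.
    if bval (f ! j) = bval (f ! i) then q j \<le> q i
    else q j - q i < of_int (ival (Z ! bval (f ! j) ! j) - ival (Z ! bval (f ! i) ! j)))"
proof -
  have "admits (weights Z f ! i ! j) (q j - q i) \<longleftrightarrow> (if bval (f ! j) = bval (f ! i) then q j \<le> q i
    else q j - q i < of_int (ival (Z ! bval (f ! j) ! j) - ival (Z ! bval (f ! i) ! j)))"
    if ij: "i < length f" "j < length f" for i j and q :: "nat \<Rightarrow> rat"
  proof -
    have lt: "bval (f ! i) < length Z" using Z ij by auto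
    then have hd: "hd (lookup Z (f ! i)) = Z ! bval (f ! i)"
      using lookup(1)[of Z "f ! i"] lookup(2)[of "f ! i" Z] by (simp add: hd_conv_nth)
    moreover have "length (Z ! bval (f ! i)) = length f" using Z lt by auto
    ultimately show ?thesis
      using ij Z by (auto simp: weights_def own_values admits_def ival_def)
  qed
  moreover have "length (weights Z f) = length f" by (simp add: weights_def)
  ultimately show ?thesis unfolding feasible_def by simp
qed

section \<open>Digit strings without leading zeros and valid inputs\<close>

definition canonical :: "bool list \<Rightarrow> bool" where
  "canonical bs = (case rev bs of [] \<Rightarrow> True | b # _ \<Rightarrow> b)"

lemma canonical_Nil [simp]: "canonical []"
  by (simp add: canonical_def)

lemma canonical_Cons: "canonical (b # bs) \<longleftrightarrow> (if bs = [] then b else canonical bs)"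
  by (cases bs rule: rev_cases) (auto simp: canonical_def)

lemma canonical_bval_pos: "canonical bs \<Longrightarrow> bs \<noteq> [] \<Longrightarrow> 0 < bval bs"
  by (induction bs) (auto simp: canonical_Cons split: if_splits)

lemma nat_bits_bval: "canonical bs \<Longrightarrow> nat_bits (bval bs) = bs"
proof (induction bs)
  case Nil
  then show ?case by (simp add: nat_bits.simps)
next
  case (Cons b bs)
  then have "0 < bval (b # bs)" by (intro canonical_bval_pos) auto
  moreover have "nat_bits (bval bs) = bs"
    using Cons by (cases "bs = []") (auto simp: canonical_Cons nat_bits.simps)
  ultimately show ?case by (subst nat_bits.simps) simp
qed

lemma nat_bits: "canonical (nat_bits n)" "bval (nat_bits n) = n"
proof (induction n rule: less_induct)
  case (less n)
  have eq: "nat_bits n = (if n = 0 then [] else odd n # nat_bits (n div 2))" by (rule nat_bits.simps)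
  have Nil: "nat_bits (n div 2) = [] \<longleftrightarrow> n div 2 = 0" by (subst nat_bits.simps) simp
  { case 1
    show ?case
    proof (cases "n div 2 = 0")
      case True
      then have "n = 0 \<or> odd n" by presburger
      then show ?thesis using True Nil by (auto simp: eq canonical_Cons)
    next
      case False
      then show ?thesis using less(1)[of "n div 2"] Nil by (auto simp: eq canonical_Cons)
    qed }
  { case 2
    show ?case using less(2)[of "n div 2"] by (auto simp: eq) }
qed

abbreviation code_bits :: "bool list \<Rightarrow> bool list" where
  "code_bits \<equiv> enc_list (\<lambda>b. [b])"

definition code_frac :: "frac \<Rightarrow> bool list" where
  "code_frac z = [fst z] @ (code_bits (fst (snd z)) @ code_bits (snd (snd z)))"

text \<open>This is the instance encoding with digit strings in place of numbers. Only bits, pairs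
  and lists occur in it, so the general parsers apply and no number has to be converted.\<close>

definition code_raw :: "frac list list \<times> bool list list \<Rightarrow> bool list" where
  "code_raw z = enc_list (enc_list code_frac) (fst z) @ enc_list code_bits (snd z)"

lemma decodable_raw: "decodable code_raw"
  unfolding code_raw_def code_frac_def
  by (intro decodable_pair decodable_list decodable_pair[where e = "\<lambda>b. [b]"] decodable_bit)

definition frac_of :: "frac \<Rightarrow> int \<times> nat" where
  "frac_of z = (if fst z then - int (bval (fst (snd z))) else int (bval (fst (snd z))), bval (snd (snd z)))"

text \<open>Exactly the strings that \<open>enc_frac\<close> can produce from a positive
  denominator: a nonempty canonical string is positive, and a zero numerator must not carry the sign
  bit, which stands for \<open>a < 0\<close>.\<close>

definition good_frac :: "frac \<Rightarrow> bool" where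
  "good_frac z \<longleftrightarrow> canonical (fst (snd z)) \<and> canonical (snd (snd z)) \<and> snd (snd z) \<noteq> [] \<and>
     (if fst z then fst (snd z) \<noteq> [] else True)"

definition instance_of :: "frac list list \<times> bool list list \<Rightarrow> sa_instance" where
  "instance_of z = \<lparr>val_table = map (map frac_of) (fst z), scf_table = map bval (snd z)\<rparr>"

definition good_raw :: "frac list list \<times> bool list list \<Rightarrow> bool" where
  "good_raw z \<longleftrightarrow> list_all (\<lambda>row. length row = length (snd z) \<and> list_all good_frac row) (fst z) \<and>
     list_all (\<lambda>x. canonical x \<and> lookup (fst z) x \<noteq> []) (snd z)"

lemma good_raw_iff: "good_raw z \<longleftrightarrow>
    (\<forall>row\<in>set (fst z). length row = length (snd z) \<and> (\<forall>a\<in>set row. good_frac a)) \<and>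
    (\<forall>x\<in>set (snd z). canonical x \<and> bval x < length (fst z))"
  by (simp add: good_raw_def list_all_iff lookup)

lemma ptime_good_raw: "ptime good_raw"
  unfolding good_raw_def good_frac_def canonical_def
  by (intro ptime_intros ptime_lookup)

lemma enc_list_map:
  "(\<And>x. x \<in> set xs \<Longrightarrow> e (h x) = e' x) \<Longrightarrow> enc_list e (map h xs) = enc_list e' xs"
  by (simp add: enc_list_def comp_def cong: map_cong)

lemma enc_frac_of: "good_frac z \<Longrightarrow> enc_frac (frac_of z) = code_frac z"
  using canonical_bval_pos[of "fst (snd z)"]
  by (auto simp: good_frac_def frac_of_def enc_frac_def code_frac_def enc_nat_def nat_bits_bval)

lemma enc_instance_of:
  assumes "good_raw z" shows "enc_instance (instance_of z) = code_raw z"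
proof -
  have "enc_list (enc_list enc_frac) (map (map frac_of) (fst z)) = enc_list (enc_list code_frac) (fst z)"
    using assms by (intro enc_list_map enc_frac_of) (auto simp: good_raw_iff)
  moreover have "enc_list enc_nat (map bval (snd z)) = enc_list code_bits (snd z)"
    using assms by (intro enc_list_map) (auto simp: good_raw_iff enc_nat_def nat_bits_bval)
  ultimately show ?thesis by (simp add: enc_instance_def instance_of_def code_raw_def)
qed

lemma valid_instance_of:
  assumes "good_raw z" shows "valid_instance (instance_of z)"
  using assms canonical_bval_pos
  by (fastforce simp: valid_instance_def instance_of_def good_raw_iff frac_of_def good_frac_def
      types_def choices_def scf_def)

text \<open>Writing every number by \<open>nat_bits\<close> supplies the raw data, so checking
  \<open>good_raw\<close> after parsing excludes no valid instance.\<close>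

lemma valid_instance_raw:
  assumes "valid_instance I"
  obtains z where "good_raw z" "instance_of z = I"
proof -
  define g where "g p = (fst p < 0, nat_bits (nat \<bar>fst p\<bar>), nat_bits (snd p))" for p :: "int \<times> nat"
  have g: "frac_of (g p) = p" for p
    by (cases p) (auto simp: g_def frac_of_def nat_bits)
  have "nat_bits n \<noteq> []" if "n > 0" for n using that by (simp add: nat_bits.simps)
  then have good_g: "good_frac (g p)" if "snd p > 0" for p
    using that by (auto simp: g_def good_frac_def nat_bits)
  let ?z = "(map (map g) (val_table I), map nat_bits (scf_table I))"
  have "instance_of ?z = I" by (simp add: instance_of_def g nat_bits comp_def)
  moreover have "good_raw ?z"
    using assms good_g
    by (fastforce simp: good_raw_iff valid_instance_def types_def choices_def scf_def nat_bits in_set_conv_nth)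
  ultimately show ?thesis using that by blast
qed

lemma ival_scale:
  assumes "good_frac z" "snd (snd z) \<in> set dens"
  shows "of_int (ival (scale dens z)) =
    of_nat (prod_list (map bval dens)) * (case frac_of z of (a, b) \<Rightarrow> of_int a / (of_nat b :: rat))"
proof -
  let ?b = "bval (snd (snd z))" and ?P = "prod_list (map bval (remove_val (snd (snd z)) dens))"
  have "?b > 0" using assms(1) canonical_bval_pos by (simp add: good_frac_def)
  moreover have "of_nat (prod_list (map bval dens)) = (of_nat ?b :: rat) * of_nat ?P"
    using prod_remove_val[OF assms(2)] by (metis of_nat_mult)
  ultimately show ?thesis
    by (simp add: scale_def ival_def bval_bprod frac_of_def)
qed

text \<open>Multiplication by the positive number \<open>D\<close> makes all valuations integers and
  preserves strict inequalities; for an empty table, \<open>D\<close> is the empty product 1.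
  Payments and potentials differ by the factor \<open>- D\<close>.\<close>

lemma decide_correct:
  assumes "good_raw z"
  shows "decide_feasible (weights (scaled (fst z)) (snd z)) \<longleftrightarrow>
    strongly_implementable (choices (instance_of z)) (types (instance_of z))
      (valuation (instance_of z)) (scf (instance_of z))"
proof -
  obtain tab f where z: "z = (tab, f)" by (cases z)
  let ?I = "instance_of z" and ?Z = "scaled tab"
  let ?V = "valuation ?I" and ?F = "scf ?I"
  define D :: rat where "D = of_nat (prod_list (map bval (denominators tab)))"
  have Z: "\<forall>row\<in>set ?Z. length row = length f" "\<forall>x\<in>set f. bval x < length ?Z"
    using assms by (auto simp: good_raw_iff z scaled_def)
  have "bval x > 0" if "x \<in> set (denominators tab)" for x
    using that assms canonical_bval_pos by (auto simp: denominators_def good_raw_iff z good_frac_def)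
  then have "0 \<notin> bval ` set (denominators tab)" by (metis imageE less_irrefl)
  then have "prod_list (map bval (denominators tab)) \<noteq> 0" by (simp add: prod_list_zero_iff)
  then have "D > 0" by (simp add: D_def)
  have types: "types ?I = {..<length f}" by (simp add: types_def instance_of_def z)
  have F: "?F i = bval (f ! i)" if "i < length f" for i
    using that by (simp add: scf_def instance_of_def z)
  have V: "of_int (ival (?Z ! bval (f ! i) ! j)) = D * ?V (?F i) j" if "i < length f" "j < length f" for i j
  proof -
    have i: "bval (f ! i) < length tab" using Z(2) that by (auto simp: scaled_def)
    then have row: "tab ! bval (f ! i) \<in> set tab" "length (tab ! bval (f ! i)) = length f"
      using assms by (auto simp: good_raw_iff z)
    then have "tab ! bval (f ! i) ! j \<in> set (tab ! bval (f ! i))" using that by simp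
    with row have "good_frac (tab ! bval (f ! i) ! j)"
      "snd (snd (tab ! bval (f ! i) ! j)) \<in> set (denominators tab)"
      using assms by (auto simp: good_raw_iff z denominators_def)
    from ival_scale[OF this] show ?thesis
      unfolding F[OF that(1)] using i row that by (simp add: D_def scaled_def valuation_def instance_of_def z)
  qed
  have "strongly_implementable (choices ?I) (types ?I) ?V ?F \<longleftrightarrow>
    (\<exists>p. \<forall>\<theta>\<in>types ?I. \<forall>\<theta>'\<in>types ?I. if ?F \<theta> = ?F \<theta>' then p \<theta>' \<le> p \<theta>
       else p \<theta>' - p \<theta> < ?V (?F \<theta>) \<theta> - ?V (?F \<theta>') \<theta>)"
    using valid_instance_of[OF assms] by (intro strongly_implementable_iff) (auto simp: valid_instance_def)
  also have "\<dots> \<longleftrightarrow> (\<exists>q :: nat \<Rightarrow> rat. \<forall>i<length f. \<forall>j<length f.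
    if bval (f ! j) = bval (f ! i) then q j \<le> q i
    else q j - q i < of_int (ival (?Z ! bval (f ! j) ! j) - ival (?Z ! bval (f ! i) ! j)))"
    (is "(\<exists>p. ?P p) \<longleftrightarrow> (\<exists>q. ?Q q)")
  proof
    assume "\<exists>p. ?P p"
    then obtain p where p: "?P p" ..
    have "?Q (\<lambda>i. - D * p i)"
    proof (intro allI impI)
      fix i j assume "i < length f" "j < length f"
      with p \<open>D > 0\<close> show "if bval (f ! j) = bval (f ! i) then - D * p j \<le> - D * p i
        else - D * p j - - D * p i < of_int (ival (?Z ! bval (f ! j) ! j) - ival (?Z ! bval (f ! i) ! j))"
        using mult_strict_left_mono[of "p i - p j" "?V (?F j) j - ?V (?F i) j" D]
        by (auto simp: types F V algebra_simps split: if_splits)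
    qed
    then show "\<exists>q. ?Q q" by (rule exI[where P = ?Q])
  next
    assume "\<exists>q. ?Q q"
    then obtain q where q: "?Q q" ..
    have "?P (\<lambda>i. - q i / D)"
    proof (intro ballI)
      fix \<theta> \<theta>' assume t: "\<theta> \<in> types ?I" "\<theta>' \<in> types ?I"
      then have *: "if ?F \<theta> = ?F \<theta>' then q \<theta> \<le> q \<theta>' else q \<theta> - q \<theta>' < D * (?V (?F \<theta>) \<theta> - ?V (?F \<theta>') \<theta>)"
        using q[rule_format, of \<theta>' \<theta>] by (simp add: types F V right_diff_distrib split: if_splits)
      have "- q \<theta>' / D - - q \<theta> / D = (q \<theta> - q \<theta>') / D" by (simp add: diff_divide_distrib)
      then show "if ?F \<theta> = ?F \<theta>' then - q \<theta>' / D \<le> - q \<theta> / D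
          else - q \<theta>' / D - - q \<theta> / D < ?V (?F \<theta>) \<theta> - ?V (?F \<theta>') \<theta>"
        using * \<open>D > 0\<close> by (auto simp: pos_divide_less_eq divide_right_mono mult.commute)
    qed
    then show "\<exists>p. ?P p" by (rule exI[where P = ?P])
  qed
  also have "\<dots> \<longleftrightarrow> decide_feasible (weights ?Z f)"
    using decide_feasible[OF weights_square[OF Z]] weights_feasible[OF Z] by simp
  finally show ?thesis by (simp add: z)
qed

theorem theorem7: "single_agent_strong_implementability \<in> class_P"
proof -
  obtain d where d: "ptime d" "\<And>w z. d w = Some z \<longleftrightarrow> w = code_raw z"
    using decodableD[OF decodable_raw] by blast
  let ?D = "\<lambda>w. case d w of None \<Rightarrow> False
    | Some z \<Rightarrow> good_raw z \<and> decide_feasible (weights (scaled (fst z)) (snd z))"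
  have "ptime ?D"
    by (intro ptime_intros d(1) ptime_comp[OF _ ptime_good_raw] ptime_comp[OF _ ptime_decide_feasible]
        ptime_weights ptime_scaled)
  moreover have "?D w \<longleftrightarrow> w \<in> single_agent_strong_implementability" for w
  proof
    assume "?D w"
    then obtain z where z: "d w = Some z" "good_raw z" "decide_feasible (weights (scaled (fst z)) (snd z))"
      by (auto split: option.splits)
    then have "w = enc_instance (instance_of z)" using d(2) enc_instance_of by simp
    then show "w \<in> single_agent_strong_implementability"
      using z valid_instance_of decide_correct unfolding single_agent_strong_implementability_def by blast
  next
    assume "w \<in> single_agent_strong_implementability"
    then obtain I where I: "w = enc_instance I" "valid_instance I"
      "strongly_implementable (choices I) (types I) (valuation I) (scf I)"
      unfolding single_agent_strong_implementability_def by blast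
    obtain z where z: "good_raw z" "instance_of z = I" by (rule valid_instance_raw[OF I(2)])
    \<comment> \<open>The parser inverts \<open>code_raw\<close> exactly, so it returns this very
      \<open>z\<close> and not merely some other description of \<open>I\<close>.\<close>
    then have "d w = Some z" using d(2) enc_instance_of[OF z(1)] I(1) by simp
    then show "?D w" using z I(3) decide_correct by simp
  qed
  ultimately show ?thesis by (rule ptime_class_P)
qed

end
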